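(* For every positive integer $t$, as power series in $q$, the generating function $\widehat F_t(x;q)=\sum_{\lambda\lambda\in\mathcal{DD}}x^{\widehat n_t(\lambda\lambda)}q^{|\lambda\lambda|}$ equals \[ (-q^2;q^2)_\infty\left((1-x)q^{2t};q^{2t}\right)_\infty^{\frac{t-1}{2}}\left((1-x)q^{2t};q^{4t}\right)_\infty \] if $t$ is odd, and equals \[ (-q^2;q^2)_\infty\left((1-x)q^{2t};q^{2t}\right)_\infty^{\frac{t-2}{2}}\left((1-x)q^{2t};q^{4t}\right)_\infty\times\frac12\Big(\left(-\sqrt{1-x}\,q^t;-q^t\right)_\infty+\left(\sqrt{1-x}\,q^t;-q^t\right)_\infty\Big) \] if $t$ is even.
   Context: Notation: $(a;q)_\infty=\prod_{k\ge1}(1-aq^{k-1})$. (The even-$t$ expression does not depend on the choice of $\sqrt{1-x}$.) A partition is a finite weakly decreasing sequence of positive integers (the empty partition included); $|\lambda|$ is the sum of its parts. The box $(i,j)$ is the box in row $i$, column $j$ of the Young diagram. The hook of a box consists of the box itself and all boxes to its right in the same row or below it in the same column; the hook length is the number of boxes in the hook; a $t$-hook is a hook of length $t$. $\widehat n_t(\lambda)$ denotes the number of $t$-hooks of $\lambda$ above the main diagonal, i.e. the number of boxes $(i,j)$ with $j>i$ whose hook length is $t$. A strict partition is a partition into distinct parts. For a strict partition $\lambda=(\lambda_1>\dots>\lambda_\ell)$, the doubled distinct partition $\lambda\lambda$ is obtained from the shifted Young diagram of $\lambda$ (row $i$ moved right by $i-1$ boxes) by adding $\lambda_i$ boxes to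 the $(i-1)$-st column for each $i$; equivalently, $\lambda\lambda$ is the partition of $2|\lambda|$ with Frobenius symbol $\begin{pmatrix}\lambda_1&\cdots&\lambda_\ell\\ \lambda_1-1&\cdots&\lambda_\ell-1\end{pmatrix}$ (the Frobenius symbol of $\mu$ with Durfee square of side $s$ has top row $\mu_i-i$ and bottom row $\mu'_i-i$, $1\le i\le s$, where $\mu'$ is the conjugate partition). E.g. $\lambda=(5,4,1)$ gives $\lambda\lambda=(6,6,4,2,2)$. $\mathcal{DD}$ is the set of all doubled distinct partitions (including the empty one). *)

theory Defs
  imports "HOL-Analysis.Analysis" "HOL-Computational_Algebra.Computational_Algebra"
begin

unbundle fps_syntax

definition is_partition :: "nat list \<Rightarrow> bool" where
  "is_partition \<mu> \<longleftrightarrow> sorted_wrt (\<ge>) \<mu> \<and> (\<forall>p\<in>set \<mu>. 0 < p)"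

definition is_strict_partition :: "nat list \<Rightarrow> bool" where
  "is_strict_partition \<nu> \<longleftrightarrow> is_partition \<nu> \<and> distinct \<nu>"

text \<open>Rows and columns are counted from 0, so \<open>(i, j)\<close> here is the box usually called
  \<open>(i + 1, j + 1)\<close>.\<close>

definition young :: "nat list \<Rightarrow> (nat \<times> nat) set" where
  "young \<mu> = {(i, j). i < length \<mu> \<and> j < \<mu> ! i}"

definition hook :: "nat list \<Rightarrow> nat \<times> nat \<Rightarrow> (nat \<times> nat) set" where
  "hook \<mu> = (\<lambda>(i, j). {(r, c) \<in> young \<mu>. (r = i \<and> c \<ge> j) \<or> (c = j \<and> r \<ge> i)})"

definition hook_length :: "nat list \<Rightarrow> nat \<times> nat \<Rightarrow> nat" where
  "hook_length \<mu> b = card (hook \<mu> b)"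

definition nhat :: "nat \<Rightarrow> nat list \<Rightarrow> nat" where
  "nhat t \<mu> = card {(i, j) \<in> young \<mu>. j > i \<and> hook_length \<mu> (i, j) = t}"

text \<open>In the shifted diagram of \<open>\<nu>\<close> the 1-based row \<open>i\<close> occupies the columns
  \<open>i, \<dots>, i + \<nu>\<^sub>i - 1\<close>.  Column 0, to the left of it, also receives boxes when the diagram is
  doubled, so these column numbers are already the 0-based ones of the doubled diagram.\<close>

definition shifted_diagram :: "nat list \<Rightarrow> (nat \<times> nat) set" where
  "shifted_diagram \<nu> = {(i, j). i < length \<nu> \<and> i < j \<and> j \<le> i + \<nu> ! i}"

text \<open>The 0-based column \<open>j\<close> of the shifted diagram of a strict partition consists of boxes in
  rows \<open>0, \<dots>, j - 1\<close> only (in all of these rows if \<open>j < length \<nu>\<close>), so the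
  \<open>\<nu> ! j\<close> boxes added to that column start in row \<open>j\<close>.\<close>

definition added_boxes :: "nat list \<Rightarrow> (nat \<times> nat) set" where
  "added_boxes \<nu> = {(i, j). j < length \<nu> \<and> j \<le> i \<and> i < j + \<nu> ! j}"

definition is_doubling :: "nat list \<Rightarrow> nat list \<Rightarrow> bool" where
  "is_doubling \<nu> \<mu> \<longleftrightarrow> is_partition \<mu> \<and> young \<mu> = shifted_diagram \<nu> \<union> added_boxes \<nu>"

lemma is_doubling_example: "is_doubling [5, 4, 1] [6, 6, 4, 2, 2]"
proof -
  have "(i, j) \<in> young [6, 6, 4, 2, 2] \<longleftrightarrow>
      (i, j) \<in> shifted_diagram [5, 4, 1] \<union> added_boxes [5, 4, 1]" for i j
    unfolding young_def shifted_diagram_def added_boxes_def by (simp add: nth_Cons') arith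
  then show ?thesis
    by (auto simp: is_doubling_def is_partition_def)
qed

definition DD :: "nat list set" where
  "DD = {\<mu>. \<exists>\<nu>. is_strict_partition \<nu> \<and> is_doubling \<nu> \<mu>}"

lemma finite_DD_size: "finite {\<mu> \<in> DD. sum_list \<mu> = n}"
proof (rule finite_subset)
  have "length \<mu> \<le> sum_list \<mu>" if "\<forall>p\<in>set \<mu>. 0 < p" for \<mu> :: "nat list"
    using that by (induction \<mu>) auto
  moreover have "p \<le> sum_list \<mu>" if "p \<in> set \<mu>" for p and \<mu> :: "nat list"
    using that by (simp add: member_le_sum_list)
  ultimately show "{\<mu> \<in> DD. sum_list \<mu> = n} \<subseteq> {\<mu>. set \<mu> \<subseteq> {..n} \<and> length \<mu> \<le> n}"
    by (auto simp: DD_def is_doubling_def is_partition_def)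
  show "finite {\<mu>. set \<mu> \<subseteq> {..n} \<and> length \<mu> \<le> n}"
    by (rule finite_lists_length_le) simp
qed

text \<open>The inner sums are finite by \<open>finite_DD_size\<close>.  The variable \<open>x\<close> is an arbitrary ring element;
  an indeterminate \<open>x\<close> for which \<open>1 - x\<close> also has a square root is available, for instance, in
  \<^typ>\<open>rat fls\<close>.\<close>

definition Fhat :: "nat \<Rightarrow> 'a \<Rightarrow> 'a::comm_ring_1 fps" where
  "Fhat t x = Abs_fps (\<lambda>n. \<Sum>\<mu> | \<mu> \<in> DD \<and> sum_list \<mu> = n. x ^ nhat t \<mu>)"

text \<open>The infinite product is taken in the \<open>X\<close>-adic topology of \<^typ>\<open>'a fps\<close>.\<close>

definition qpoch :: "'a::comm_ring_1 fps \<Rightarrow> 'a fps \<Rightarrow> 'a fps" where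
  "qpoch a q = prodinf (\<lambda>k. 1 - a * q ^ k)"

lemma has_prod_qpoch:
  fixes a q :: "'a::idom fps"
  assumes "a $ 0 = 0" "q $ 0 = 0"
  shows "(\<lambda>k. 1 - a * q ^ k) has_prod qpoch a q"
proof -
  define P where "P n = (\<Prod>k\<le>n. 1 - a * q ^ k)" for n
  have q0: "(a * q ^ k) $ i = 0" if "i \<le> k" for i k
  proof -
    have "(q ^ k) $ j = 0" if "j < k" for j
      using that assms(2) by (simp add: startsby_zero_power_prefix)
    moreover have "(a * q ^ k) $ i = (\<Sum>j=0..i. a $ j * (q ^ k) $ (i - j))"
      by (rule fps_mult_nth)
    moreover have "a $ j * (q ^ k) $ (i - j) = 0" if "j \<in> {0..i}" for j
      using that \<open>i \<le> k\<close> assms(1) calculation(1)[of "i - j"] by (cases "j = 0") auto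
    ultimately show ?thesis by simp
  qed
  have step: "P (Suc n) $ i = P n $ i" if "i \<le> n" for n i
  proof -
    have "P (Suc n) = P n - P n * (a * q ^ Suc n)"
      by (simp add: P_def algebra_simps)
    moreover have "(P n * (a * q ^ Suc n)) $ i = 0"
      by (rule fps_mult_nth[THEN trans], rule sum.neutral, rule ballI)
        (subst q0, use that in auto)
    ultimately show ?thesis by simp
  qed
  define L where "L = Abs_fps (\<lambda>i. P i $ i)"
  have stable: "P n $ i = L $ i" if "i \<le> n" for n i
    using that by (induction n rule: dec_induct) (simp_all add: L_def step)
  have "P \<longlonglongrightarrow> L"
    unfolding tendsto_iff
  proof safe
    fix e :: real assume "e > 0"
    then obtain N where N: "(1/2) ^ N < e"
      using real_arch_pow_inv[of e "1/2"] by auto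
    have "dist (P n) L < e" if "n \<ge> N" for n
    proof (cases "P n = L")
      case False
      have "subdegree (P n - L) \<ge> n"
        using False stable by (intro subdegree_geI) auto
      then have "inverse (2 ^ subdegree (P n - L)) \<le> inverse (2 ^ N :: real)"
        using that by (intro le_imp_inverse_le power_increasing) auto
      then show ?thesis
        using N False by (simp add: dist_fps_def power_one_over inverse_eq_divide)
    qed (use \<open>e > 0\<close> in simp)
    then show "\<forall>\<^sub>F n in sequentially. dist (P n) L < e"
      by (auto simp: eventually_sequentially)
  qed
  moreover have "L $ 0 = 1"
    using assms by (simp add: L_def P_def)
  then have "L \<noteq> 0" by auto
  ultimately have "(\<lambda>k. 1 - a * q ^ k) has_prod L"
    by (auto simp: has_prod_def raw_has_prod_def P_def[abs_def])
  then show ?thesis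
    unfolding qpoch_def using has_prod_unique by metis
qed

end

theory Submission
  imports Defs
begin

unbundle no vec_syntax

text \<open>The hook lengths of the boxes above the diagonal of a doubled distinct partition are the bar
  lengths of the underlying strict partition \<open>S\<close>, seen as a finite set of positive integers.  So the
  exponent of \<open>x\<close> is the number of \<open>a \<in> S\<close> with \<open>a \<ge> t\<close> and \<open>a - t \<notin> S\<close>, plus the number of pairs
  \<open>a < b\<close> in \<open>S\<close> with \<open>a + b = t\<close>.  This statistic splits over the classes \<open>\<plusminus>i\<close> of residues modulo \<open>t\<close>,
  and so the generating function is a product over these classes.

  Put \<open>y = 1 - x\<close> and \<open>Q = q\<^bsup>2t\<^esup>\<close>.  Within one residue class, the generating function of the sets
  whose elements are at least \<open>b\<close> solves a linear three-term recurrence in \<open>b\<close>.  Its solution is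
  determined by its limit, and comparing solutions for \<open>y\<close> and \<open>yQ\<close> gives linear relations between
  them (this is why \<open>y\<close> is allowed to be a power series).  Each class then satisfies
  a first-order functional equation in \<open>y\<close>, which yields its product; at \<open>y = 0\<close> the classes together
  give \<open>(-q\<^sup>2; q\<^sup>2)\<^sub>\<infinity>\<close>.  For \<open>t\<close> even the class \<open>t/2\<close> obeys instead a \<open>2 \<times> 2\<close> system, which is also
  the system for the even and odd parts in \<open>s\<close> of \<open>(-sq\<^sup>t; -q\<^sup>t)\<^sub>\<infinity>\<close>, where \<open>y = s\<^sup>2\<close>.\<close>

subsection \<open>Congruences of power series\<close>

text \<open>Divisibility of a difference by \<open>fps_X ^ n\<close> means agreement of the first
  \<open>n\<close> coefficients. Limits of power series are handled below as congruences of this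
  kind.\<close>

lemma fps_X_power_dvd_iff:
  fixes f :: "'a::comm_ring_1 fps"
  shows "fps_X ^ n dvd f \<longleftrightarrow> (\<forall>k<n. f $ k = 0)"
proof
  assume "\<forall>k<n. f $ k = 0"
  then have "f = fps_X ^ n * fps_shift n f"
    by (intro fps_ext) (auto simp: fps_X_power_mult_nth)
  then show "fps_X ^ n dvd f"
    by (rule dvdI)
qed (auto simp: dvd_def fps_X_power_mult_nth)

lemma fps_eqI_dvd:
  fixes f g :: "'a::comm_ring_1 fps"
  assumes "\<And>n. fps_X ^ n dvd f - g"
  shows "f = g"
proof (rule fps_ext)
  fix n
  show "f $ n = g $ n"
    using assms[of "Suc n"] by (simp add: fps_X_power_dvd_iff del: power_Suc)
qed

lemma dvd_diff_mult:
  fixes a b c d m :: "'a::comm_ring_1"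
  assumes "m dvd a - b" "m dvd c - d"
  shows "m dvd a * c - b * d"
proof -
  have "a * c - b * d = (a - b) * c + b * (c - d)"
    by (simp add: algebra_simps)
  then show ?thesis
    using assms by (simp add: dvd_mult dvd_mult2)
qed

lemma dvd_diff_add:
  fixes a b c d m :: "'a::comm_ring_1"
  assumes "m dvd a - b" "m dvd c - d"
  shows "m dvd (a + c) - (b + d)"
proof -
  have "(a + c) - (b + d) = (a - b) + (c - d)"
    by (simp add: algebra_simps)
  then show ?thesis
    using assms by (simp only: dvd_add)
qed

lemma dvd_diff_diff:
  fixes a b c d m :: "'a::comm_ring_1"
  assumes "m dvd a - b" "m dvd c - d"
  shows "m dvd (a - c) - (b - d)"
proof -
  have "(a - c) - (b - d) = (a - b) - (c - d)"
    by (simp add: algebra_simps)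
  then show ?thesis
    using assms by (simp only: dvd_diff)
qed

lemma dvd_diff_power:
  fixes a b m :: "'a::comm_ring_1"
  assumes "m dvd a - b"
  shows "m dvd a ^ n - b ^ n"
  by (induction n) (auto intro: dvd_diff_mult assms)

lemma dvd_diff_prod:
  fixes f g :: "'b \<Rightarrow> 'a::comm_ring_1"
  assumes "\<And>i. i \<in> I \<Longrightarrow> m dvd f i - g i"
  shows "m dvd prod f I - prod g I"
  using assms by (induction I rule: infinite_finite_induct) (auto intro!: dvd_diff_mult)

lemma dvd_diff_trans:
  fixes a b c m :: "'a::comm_ring_1"
  assumes "m dvd a - b" "m dvd b - c"
  shows "m dvd a - c"
  using dvd_add[OF assms] by simp

lemma dvd_diff_sym:
  fixes a b m :: "'a::comm_ring_1"
  assumes "m dvd a - b"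
  shows "m dvd b - a"
  using assms dvd_minus_iff[of m "a - b"] by simp

subsection \<open>Generating functions of finite sets\<close>

text \<open>Sets with an element beyond \<open>n\<close> do not contribute to the coefficient of \<open>X\<^sup>n\<close>, so cutting
  \<open>A\<close> at \<open>n\<close> makes this the sum over all finite subsets of \<open>A\<close>.\<close>

definition subset_gf :: "(nat set \<Rightarrow> 'a::comm_ring_1 fps) \<Rightarrow> nat set \<Rightarrow> 'a fps" where
  "subset_gf f A = Abs_fps (\<lambda>n. (\<Sum>S\<in>Pow (A \<inter> {..n}). fps_X ^ (2 * \<Sum>S) * f S) $ n)"

lemma subset_gf_nth:
  assumes "n \<le> N"
  shows "subset_gf f A $ n = (\<Sum>S\<in>Pow (A \<inter> {..N}). fps_X ^ (2 * \<Sum>S) * f S) $ n"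
proof -
  have "(fps_X ^ (2 * \<Sum>S) * f S) $ n = 0"
    if S: "S \<in> Pow (A \<inter> {..N}) - Pow (A \<inter> {..n})" for S
  proof -
    from S obtain a where "a \<in> S" "a > n" by force
    moreover have "finite S"
      using S by (auto intro: finite_subset[of _ "{..N}"])
    ultimately have "n < \<Sum>S"
      using member_le_sum[of a S "\<lambda>a. a"] by auto
    then show ?thesis
      by (simp add: fps_X_power_mult_nth)
  qed
  then show ?thesis
    using assms unfolding subset_gf_def fps_nth_Abs_fps fps_sum_nth
    by (intro sum.mono_neutral_left) auto
qed

text \<open>Modulo a power of \<open>fps_X\<close> the series is a finite sum, so identities between
  such series reduce to finite sums. The cutoff \<open>N\<close> may exceed \<open>n\<close>, which
  \<open>subset_gf_insert\<close> exploits.\<close>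

lemma subset_gf_approx:
  assumes "n \<le> N"
  shows "fps_X ^ n dvd subset_gf f A - (\<Sum>S\<in>Pow (A \<inter> {..N}). fps_X ^ (2 * \<Sum>S) * f S)"
  unfolding fps_X_power_dvd_iff fps_sub_nth
proof (intro allI impI)
  fix k assume "k < n"
  then have "k \<le> N" using assms by simp
  from subset_gf_nth[OF this, of f A]
  show "subset_gf f A $ k - (\<Sum>S\<in>Pow (A \<inter> {..N}). fps_X ^ (2 * \<Sum>S) * f S) $ k = 0"
    by (simp only: diff_self)
qed

lemma subset_gf_cong_dvd:
  assumes "\<And>S. finite S \<Longrightarrow> S \<subseteq> A \<Longrightarrow> fps_X ^ n dvd f S - g S"
  shows "fps_X ^ n dvd subset_gf f A - subset_gf g A"
proof -
  have "subset_gf f A $ k = subset_gf g A $ k" if "k < n" for k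
  proof -
    have "fps_X ^ n dvd (\<Sum>S\<in>Pow (A \<inter> {..k}). fps_X ^ (2 * \<Sum>S) * (f S - g S))"
      using assms by (intro dvd_sum dvd_mult) (auto intro: finite_subset[of _ "{..k}"])
    then have "(\<Sum>S\<in>Pow (A \<inter> {..k}). fps_X ^ (2 * \<Sum>S) * (f S - g S)) $ k = 0"
      using that by (auto simp: fps_X_power_dvd_iff)
    then show ?thesis
      by (simp add: subset_gf_def algebra_simps sum_subtractf)
  qed
  then show ?thesis
    by (simp add: fps_X_power_dvd_iff)
qed

lemma subset_gf_cong:
  assumes "\<And>S. finite S \<Longrightarrow> S \<subseteq> A \<Longrightarrow> f S = g S"
  shows "subset_gf f A = subset_gf g A"
  using assms by (intro fps_eqI_dvd subset_gf_cong_dvd) auto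

lemma subset_gf_cmult: "subset_gf (\<lambda>S. c * f S) A = c * subset_gf f A"
proof (rule fps_eqI_dvd)
  fix n
  let ?F = "\<lambda>f. \<Sum>S\<in>Pow (A \<inter> {..n}). fps_X ^ (2 * \<Sum>S) * f S"
  have 1: "fps_X ^ n dvd subset_gf (\<lambda>S. c * f S) A - ?F (\<lambda>S. c * f S)"
    by (rule subset_gf_approx) simp
  have 2: "fps_X ^ n dvd c * subset_gf f A - c * ?F f"
    by (intro dvd_diff_mult subset_gf_approx) auto
  have 3: "c * ?F f = ?F (\<lambda>S. c * f S)"
    by (simp add: sum_distrib_left mult_ac)
  show "fps_X ^ n dvd subset_gf (\<lambda>S. c * f S) A - c * subset_gf f A"
    by (rule dvd_diff_trans[OF 1 dvd_diff_sym[OF 2[unfolded 3]]])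
qed

text \<open>A finite subset of \<open>A \<union> B\<close> is a pair of subsets, and its element sum
  splits accordingly. Three weights are allowed because the two parts may be weighted
  differently.\<close>

lemma subset_gf_union:
  assumes "A \<inter> B = {}"
    and fgh: "\<And>S T. finite S \<Longrightarrow> S \<subseteq> A \<Longrightarrow> finite T \<Longrightarrow> T \<subseteq> B \<Longrightarrow> f (S \<union> T) = g S * h T"
  shows "subset_gf f (A \<union> B) = subset_gf g A * subset_gf h B"
proof (rule fps_eqI_dvd)
  fix n
  define F where "F f A = (\<Sum>S\<in>Pow (A \<inter> {..n}). fps_X ^ (2 * \<Sum>S) * f S)"
    for f :: "nat set \<Rightarrow> 'a fps" and A
  have approx: "fps_X ^ n dvd subset_gf f A - F f A" for f :: "nat set \<Rightarrow> 'a fps" and A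
    unfolding F_def by (rule subset_gf_approx) simp
  have "F g A * F h B = (\<Sum>(S, T)\<in>Pow (A \<inter> {..n}) \<times> Pow (B \<inter> {..n}).
      fps_X ^ (2 * \<Sum>S) * g S * (fps_X ^ (2 * \<Sum>T) * h T))"
    by (simp add: F_def sum_product sum.cartesian_product)
  also have "\<dots> = F f (A \<union> B)"
    unfolding F_def
  proof (rule sum.reindex_bij_witness[where i = "\<lambda>U. (U \<inter> A, U \<inter> B)" and j = "\<lambda>(S, T). S \<union> T"], goal_cases)
    \<comment> \<open>Goal 5 compares the summands; the first four say that splitting and union are
      mutually inverse.\<close>
    case (5 p)
    then obtain S T where p: "p = (S, T)" "S \<subseteq> A \<inter> {..n}" "T \<subseteq> B \<inter> {..n}" by auto
    then have fin: "finite S" "finite T"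
      by (auto intro: finite_subset[of _ "{..n}"])
    moreover have "S \<inter> T = {}" using p assms(1) by auto
    ultimately have "\<Sum>(S \<union> T) = \<Sum>S + \<Sum>T"
      by (simp add: sum.union_disjoint)
    moreover have "f (S \<union> T) = g S * h T"
      using p fin by (intro fgh) auto
    ultimately show ?case
      using p by (simp add: power_add algebra_simps)
  qed (use assms(1) in auto)
  finally have "F g A * F h B = F f (A \<union> B)" .
  then have "fps_X ^ n dvd subset_gf g A * subset_gf h B - F f (A \<union> B)"
    using dvd_diff_mult[OF approx approx] by metis
  then show "fps_X ^ n dvd subset_gf f (A \<union> B) - subset_gf g A * subset_gf h B"
    by (rule dvd_diff_trans[OF approx dvd_diff_sym])
qed

lemma subset_gf_insert:
  assumes "b \<notin> A"
  shows "subset_gf f (insert b A) =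
    subset_gf f A + fps_X ^ (2 * b) * subset_gf (\<lambda>S. f (insert b S)) A"
proof (rule fps_eqI_dvd)
  fix n
  \<comment> \<open>The cutoff must reach \<open>b\<close>, or the truncation would drop it.\<close>
  define N where "N = max n b"
  define F where "F f A = (\<Sum>S\<in>Pow (A \<inter> {..N}). fps_X ^ (2 * \<Sum>S) * f S)"
    for f :: "nat set \<Rightarrow> 'a fps" and A
  have approx: "fps_X ^ n dvd subset_gf f A - F f A" for f :: "nat set \<Rightarrow> 'a fps" and A
    unfolding F_def by (rule subset_gf_approx) (simp add: N_def)
  let ?P = "Pow (A \<inter> {..N})"
  have fin: "finite ?P" by simp
  have "insert b A \<inter> {..N} = insert b (A \<inter> {..N})"
    by (auto simp: N_def)
  then have "F f (insert b A) = (\<Sum>S\<in>?P \<union> insert b ` ?P. fps_X ^ (2 * \<Sum>S) * f S)"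
    by (simp add: F_def Pow_insert)
  also have "\<dots> = F f A + (\<Sum>S\<in>insert b ` ?P. fps_X ^ (2 * \<Sum>S) * f S)"
    unfolding F_def using assms fin by (intro sum.union_disjoint finite_imageI) auto
  also have "(\<Sum>S\<in>insert b ` ?P. fps_X ^ (2 * \<Sum>S) * f S) =
      (\<Sum>S\<in>?P. fps_X ^ (2 * \<Sum>(insert b S)) * f (insert b S))"
    using assms by (subst sum.reindex) (auto simp: inj_on_def intro!: set_eqI)
  also have "\<dots> = (\<Sum>S\<in>?P. fps_X ^ (2 * b) * (fps_X ^ (2 * \<Sum>S) * f (insert b S)))"
  proof (rule sum.cong[OF refl])
    fix S assume "S \<in> ?P"
    then have "finite S" "b \<notin> S"
      using assms by (auto intro: finite_subset[of _ "{..N}"])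
    then show "fps_X ^ (2 * \<Sum>(insert b S)) * f (insert b S) =
        fps_X ^ (2 * b) * (fps_X ^ (2 * \<Sum>S) * f (insert b S))"
      by (simp add: power_add algebra_simps)
  qed
  also have "\<dots> = fps_X ^ (2 * b) * F (\<lambda>S. f (insert b S)) A"
    by (simp add: F_def sum_distrib_left)
  finally have F: "F f (insert b A) = F f A + fps_X ^ (2 * b) * F (\<lambda>S. f (insert b S)) A" .
  have "fps_X ^ n dvd (subset_gf f A + fps_X ^ (2 * b) * subset_gf (\<lambda>S. f (insert b S)) A)
      - F f (insert b A)"
    unfolding F by (intro dvd_diff_add dvd_diff_mult approx) simp
  then show "fps_X ^ n dvd subset_gf f (insert b A) -
      (subset_gf f A + fps_X ^ (2 * b) * subset_gf (\<lambda>S. f (insert b S)) A)"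
    by (rule dvd_diff_trans[OF approx dvd_diff_sym])
qed

lemma subset_gf_empty [simp]: "subset_gf f {} = f {}"
  by (rule fps_ext) (simp add: subset_gf_def)

text \<open>A nonempty subset has an element sum of at least \<open>n\<close>, so only the empty set
  is visible modulo \<open>fps_X ^ n\<close>. This yields the limits along chains.\<close>

lemma subset_gf_dvd_empty:
  assumes "\<And>a. a \<in> A \<Longrightarrow> n \<le> a"
  shows "fps_X ^ n dvd subset_gf f A - f {}"
proof -
  have "subset_gf f A $ k = f {} $ k" if "k < n" for k
  proof -
    have "A \<inter> {..k} = {}"
      using assms that by fastforce
    then show ?thesis
      by (simp add: subset_gf_def del: Pow_Int_eq)
  qed
  then show ?thesis
    by (simp add: fps_X_power_dvd_iff)
qed

lemma subset_gf_UN: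
  fixes f :: "nat set \<Rightarrow> 'a::comm_ring_1 fps"
  assumes "finite I" "f {} = 1"
    and disj: "\<And>i j. i \<in> I \<Longrightarrow> j \<in> I \<Longrightarrow> i \<noteq> j \<Longrightarrow> A i \<inter> A j = {}"
    and mult: "\<And>i J S T. i \<in> I \<Longrightarrow> J \<subseteq> I - {i} \<Longrightarrow> finite S \<Longrightarrow> S \<subseteq> A i \<Longrightarrow> finite T \<Longrightarrow>
      T \<subseteq> (\<Union>j\<in>J. A j) \<Longrightarrow> f (S \<union> T) = f S * f T"
  shows "subset_gf f (\<Union>i\<in>I. A i) = (\<Prod>i\<in>I. subset_gf f (A i))"
proof -
  have "subset_gf f (\<Union>i\<in>J. A i) = (\<Prod>i\<in>J. subset_gf f (A i))" if "finite J" "J \<subseteq> I" for J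
    using that
  proof (induction J)
    case (insert i J)
    have "subset_gf f (A i \<union> (\<Union>i\<in>J. A i)) = subset_gf f (A i) * subset_gf f (\<Union>i\<in>J. A i)"
    proof (rule subset_gf_union)
      show "A i \<inter> (\<Union>i\<in>J. A i) = {}"
        using disj insert.hyps insert.prems by fast
      show "f (S \<union> T) = f S * f T" if "finite S" "S \<subseteq> A i" "finite T" "T \<subseteq> (\<Union>i\<in>J. A i)" for S T
        using that insert.hyps insert.prems by (intro mult[of i J]) auto
    qed
    then show ?case
      using insert by simp
  qed (use assms(2) in simp)
  then show ?thesis
    using assms(1) by blast
qed

subsection \<open>Infinite products\<close>

lemma qpoch_approx:
  fixes a q :: "'a::idom fps"
  assumes "a $ 0 = 0" "q $ 0 = 0"
  shows "\<exists>N. \<forall>n\<ge>N. fps_X ^ i dvd (\<Prod>k<n. 1 - a * q ^ k) - qpoch a q"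
proof -
  have "\<forall>k<i. eventually (\<lambda>n. (\<Prod>j<n. 1 - a * q ^ j) $ k = qpoch a q $ k) sequentially"
    using has_prod_imp_tendsto'[OF has_prod_qpoch[OF assms]] unfolding tendsto_fps_iff by blast
  then have "eventually (\<lambda>n. \<forall>k\<in>{..<i}. (\<Prod>j<n. 1 - a * q ^ j) $ k = qpoch a q $ k) sequentially"
    by (intro eventually_ball_finite) auto
  then show ?thesis
    by (simp add: fps_X_power_dvd_iff eventually_sequentially Ball_def)
qed

text \<open>Iterating \<open>rec\<close> writes \<open>F 0\<close> as a partial product times
  \<open>F n\<close>; for growing \<open>n\<close> these tend to the infinite product and to
  \<open>L\<close>. The first-order functional equations below are solved this way.\<close>

lemma qpoch_eqI:
  fixes a q :: "'a::idom fps"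
  assumes "a $ 0 = 0" "q $ 0 = 0"
    and rec: "\<And>n. F n = (1 - a * q ^ n) * F (Suc n)"
    and lim: "\<And>n. fps_X ^ n dvd F n - L"
  shows "F 0 = L * qpoch a q"
proof (rule fps_eqI_dvd)
  fix i
  have F0: "F 0 = (\<Prod>k<n. 1 - a * q ^ k) * F n" for n
  proof (induction n)
    case (Suc n)
    then show ?case
      by (simp add: rec[of n] mult.assoc)
  qed simp
  obtain N where N: "\<forall>n\<ge>N. fps_X ^ i dvd (\<Prod>k<n. 1 - a * q ^ k) - qpoch a q"
    using qpoch_approx[OF assms(1,2)] by blast
  have "fps_X ^ i dvd F (max i N) - L"
    using lim by (rule power_le_dvd) simp
  then have "fps_X ^ i dvd F 0 - qpoch a q * L"
    unfolding F0[of "max i N"] using N by (intro dvd_diff_mult) auto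
  then show "fps_X ^ i dvd F 0 - L * qpoch a q"
    by (simp only: mult.commute)
qed

lemma qpoch_unfold:
  fixes a q :: "'a::idom fps"
  assumes "a $ 0 = 0" "q $ 0 = 0"
  shows "qpoch a q = (1 - a) * qpoch (a * q) q"
proof (rule fps_eqI_dvd)
  fix i
  have "(a * q) $ 0 = 0" using assms by simp
  from qpoch_approx[OF this assms(2), of i]
  obtain N where N: "\<forall>n\<ge>N. fps_X ^ i dvd (\<Prod>k<n. 1 - a * q * q ^ k) - qpoch (a * q) q" ..
  obtain N' where N': "\<forall>n\<ge>N'. fps_X ^ i dvd (\<Prod>k<n. 1 - a * q ^ k) - qpoch a q"
    using qpoch_approx[OF assms] by blast
  define n where "n = max N N'"
  have "(\<Prod>k<Suc n. 1 - a * q ^ k) = (1 - a) * (\<Prod>k<n. 1 - a * q * q ^ k)"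
    by (subst prod.lessThan_Suc_shift) (simp add: mult_ac)
  moreover have "fps_X ^ i dvd (1 - a) * (\<Prod>k<n. 1 - a * q * q ^ k) - (1 - a) * qpoch (a * q) q"
    using N by (intro dvd_diff_mult) (auto simp: n_def)
  moreover have "fps_X ^ i dvd (\<Prod>k<Suc n. 1 - a * q ^ k) - qpoch a q"
    using N' by (auto simp: n_def simp del: prod.lessThan_Suc)
  ultimately show "fps_X ^ i dvd qpoch a q - (1 - a) * qpoch (a * q) q"
    by (metis dvd_diff_sym dvd_diff_trans)
qed

lemma qpoch_dvd_one:
  fixes a q :: "'a::idom fps"
  assumes "a $ 0 = 0" "q $ 0 = 0" "fps_X ^ i dvd a"
  shows "fps_X ^ i dvd qpoch a q - 1"
proof -
  obtain N where N: "\<forall>n\<ge>N. fps_X ^ i dvd (\<Prod>k<n. 1 - a * q ^ k) - qpoch a q"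
    using qpoch_approx[OF assms(1,2)] by blast
  have "fps_X ^ i dvd (\<Prod>k<N. 1 - a * q ^ k) - (\<Prod>k<N. 1)"
    using assms(3) by (intro dvd_diff_prod) auto
  with N show ?thesis
    by (auto intro: dvd_diff_trans dvd_diff_sym)
qed

subsection \<open>Sets in one residue class\<close>

definition chain :: "nat \<Rightarrow> nat \<Rightarrow> nat set" where
  "chain t b = range (\<lambda>k. b + t * k)"

text \<open>The case \<open>a < t\<close> is separate because \<open>a - t\<close> is truncated.\<close>

definition starts :: "nat \<Rightarrow> nat set \<Rightarrow> nat set" where
  "starts t S = {a \<in> S. a < t \<or> a - t \<notin> S}"

text \<open>The factor \<open>1 - y\<close> plays the role of \<open>x\<close>. Excluding
  \<open>b\<close> from the starts covers two situations: \<open>b - t\<close> is present in a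
  larger set, or \<open>b < t\<close> and no bar of length \<open>t\<close> can be taken from
  \<open>b\<close>.\<close>

definition chain_gf :: "nat \<Rightarrow> 'a::comm_ring_1 fps \<Rightarrow> nat \<Rightarrow> 'a fps" where
  "chain_gf t y b = subset_gf (\<lambda>S. (1 - y) ^ card (starts t S - {b})) (chain t b)"

definition full_chain_gf :: "nat \<Rightarrow> 'a::comm_ring_1 fps \<Rightarrow> nat \<Rightarrow> 'a fps" where
  "full_chain_gf t y b = subset_gf (\<lambda>S. (1 - y) ^ card (starts t S)) (chain t b)"

lemma chain_unfold: "chain t b = insert b (chain t (b + t))"
proof -
  have "range (\<lambda>k. b + t * k) = (\<lambda>k. b + t * k) ` insert 0 (range Suc)"
    by (simp add: UNIV_nat_eq[symmetric])
  then show ?thesis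
    by (simp add: chain_def image_image ac_simps)
qed

lemma chain_ge: "a \<in> chain t b \<Longrightarrow> b \<le> a"
  by (auto simp: chain_def)

lemma finite_starts: "finite S \<Longrightarrow> finite (starts t S)"
  by (simp add: starts_def)

text \<open>Everything in \<open>S\<close> is larger than \<open>b\<close>, so \<open>b\<close> is a
  start itself, and it is the predecessor of \<open>b + t\<close> only.\<close>

lemma starts_insert:
  assumes "t \<ge> 1" "S \<subseteq> chain t (b + t)"
  shows "starts t (insert b S) = insert b (starts t S - {b + t})"
proof -
  have "b + t \<le> a" if "a \<in> S" for a
    using that assms(2) chain_ge by blast
  with assms(1) show ?thesis
    unfolding starts_def by force
qed

text \<open>Sort the sets by whether they contain \<open>b\<close>. If they do, \<open>b + t\<close>
  is no longer a start, and \<open>b\<close> contributes \<open>1 - y\<close> only in the full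
  version.\<close>

lemma chain_gf_split:
  assumes "t \<ge> 1"
  shows "chain_gf t y b = full_chain_gf t y (b + t) + fps_X ^ (2 * b) * chain_gf t y (b + t)"
    and "full_chain_gf t y b =
      full_chain_gf t y (b + t) + (1 - y) * fps_X ^ (2 * b) * chain_gf t y (b + t)"
proof -
  have b: "b \<notin> chain t (b + t)"
    using assms chain_ge[of b t "b + t"] by auto
  have "subset_gf (\<lambda>S. (1 - y) ^ card (starts t S - {b})) (chain t (b + t)) =
      full_chain_gf t y (b + t)"
    unfolding full_chain_gf_def
  proof (rule subset_gf_cong)
    fix S assume "S \<subseteq> chain t (b + t)"
    then have "b \<notin> starts t S"
      using b by (auto simp: starts_def)
    then show "(1 - y) ^ card (starts t S - {b}) = (1 - y) ^ card (starts t S)"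
      by simp
  qed
  moreover have "subset_gf (\<lambda>S. (1 - y) ^ card (starts t (insert b S) - {b})) (chain t (b + t)) =
      chain_gf t y (b + t)"
    unfolding chain_gf_def
  proof (rule subset_gf_cong)
    fix S assume "S \<subseteq> chain t (b + t)"
    moreover from this have "b \<notin> starts t S"
      using b by (auto simp: starts_def)
    ultimately show "(1 - y) ^ card (starts t (insert b S) - {b}) =
        (1 - y) ^ card (starts t S - {b + t})"
      using assms by (simp add: starts_insert)
  qed
  ultimately show "chain_gf t y b =
      full_chain_gf t y (b + t) + fps_X ^ (2 * b) * chain_gf t y (b + t)"
    by (subst chain_gf_def, subst chain_unfold) (simp add: subset_gf_insert b)
  have "subset_gf (\<lambda>S. (1 - y) ^ card (starts t (insert b S))) (chain t (b + t)) =
      (1 - y) * chain_gf t y (b + t)"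
    unfolding chain_gf_def subset_gf_cmult[symmetric]
  proof (rule subset_gf_cong)
    fix S assume S: "finite S" "S \<subseteq> chain t (b + t)"
    then have "b \<notin> starts t S"
      using b by (auto simp: starts_def)
    then show "(1 - y) ^ card (starts t (insert b S)) =
        (1 - y) * (1 - y) ^ card (starts t S - {b + t})"
      using assms S by (simp add: starts_insert finite_starts)
  qed
  then show "full_chain_gf t y b =
      full_chain_gf t y (b + t) + (1 - y) * fps_X ^ (2 * b) * chain_gf t y (b + t)"
    by (subst full_chain_gf_def, subst chain_unfold)
      (simp add: subset_gf_insert b full_chain_gf_def mult_ac)
qed

lemma full_chain_gf_eq:
  assumes "t \<ge> 1"
  shows "full_chain_gf t y b = chain_gf t y b - y * fps_X ^ (2 * b) * chain_gf t y (b + t)"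
  using chain_gf_split[OF assms, of y b] by (simp add: algebra_simps)

text \<open>Eliminating \<open>full_chain_gf\<close> from the two splittings leaves a recurrence for
  \<open>chain_gf\<close> alone.\<close>

lemma chain_gf_rec:
  assumes "t \<ge> 1"
  shows "chain_gf t y b = (1 + fps_X ^ (2 * b)) * chain_gf t y (b + t)
    - y * fps_X ^ (2 * (b + t)) * chain_gf t y (b + 2 * t)"
proof -
  have "b + 2 * t = b + t + t" by simp
  then show ?thesis
    using chain_gf_split(1)[OF assms, of y b] full_chain_gf_eq[OF assms, of y "b + t"]
    by (simp only:) (simp add: algebra_simps)
qed

lemma chain_gf_dvd_one: "n \<le> b \<Longrightarrow> fps_X ^ n dvd chain_gf t y b - 1"
  unfolding chain_gf_def
  by (rule subset_gf_dvd_empty[THEN back_subst[where P = "\<lambda>f. _ dvd _ - f"]])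
    (auto simp: starts_def dest: chain_ge)

text \<open>Continuity in \<open>y\<close>, which supplies the limits when \<open>y\<close> is
  multiplied by ever higher powers of \<open>fps_X\<close>.\<close>

lemma chain_gf_cong_dvd:
  assumes "fps_X ^ n dvd y - y'"
  shows "fps_X ^ n dvd chain_gf t y b - chain_gf t y' b"
    and "fps_X ^ n dvd full_chain_gf t y b - full_chain_gf t y' b"
proof -
  have "fps_X ^ n dvd (1 - y) - (1 - y')"
    using dvd_diff_sym[OF assms] by simp
  then show "fps_X ^ n dvd chain_gf t y b - chain_gf t y' b"
    "fps_X ^ n dvd full_chain_gf t y b - full_chain_gf t y' b"
    unfolding chain_gf_def full_chain_gf_def
    by (auto intro!: subset_gf_cong_dvd dvd_diff_power)
qed

lemma chain_gf_0:
  "chain_gf t 0 b = subset_gf (\<lambda>_. 1) (chain t b)"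
  "full_chain_gf t 0 b = subset_gf (\<lambda>_. 1) (chain t b)"
  by (simp_all add: chain_gf_def full_chain_gf_def)

section \<open>Uniqueness for the recurrence, and scaling of \<open>y\<close>\<close>

text \<open>Each term is a combination of the next two, so divisibility by \<open>fps_X ^ N\<close>
  spreads downwards from the indices \<open>n \<ge> N\<close>, where \<open>lim\<close> provides it.
  Applied to a difference, this shows that the limit determines a solution.\<close>

lemma two_step_recurrence_eq_0:
  fixes D :: "nat \<Rightarrow> 'a::comm_ring_1 fps"
  assumes rec: "\<And>n. D n = u n * D (Suc n) + v n * D (Suc (Suc n))"
    and lim: "\<And>n. fps_X ^ n dvd D n"
  shows "D n = 0"
proof -
  have "fps_X ^ N dvd D n" for N
  proof (induction "N - n" arbitrary: n rule: less_induct)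
    case less
    show ?case
    proof (cases "n < N")
      case True
      then have "fps_X ^ N dvd D (Suc n)" "fps_X ^ N dvd D (Suc (Suc n))"
        by (auto intro: less)
      then show ?thesis
        by (subst rec) simp
    next
      case False
      then show ?thesis
        using lim by (intro power_le_dvd[OF lim]) simp
    qed
  qed
  then show ?thesis
    by (intro fps_eqI_dvd) simp
qed

text \<open>The right-hand sides, as sequences in the first element of the chain, satisfy the recurrence
  \<open>chain_gf_rec\<close> of the left-hand sides and have the same limit 1.\<close>

lemma chain_gf_scale:
  fixes y :: "'a::comm_ring_1 fps"
  assumes "t \<ge> 1"
  defines "Q \<equiv> fps_X ^ (2 * t)"
  shows "chain_gf t y b =
      chain_gf t (y * Q) b - y * fps_X ^ (2 * b) * Q * chain_gf t (y * Q) (b + t)"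
    and "chain_gf t y (b + t) =
      chain_gf t (y * Q) b - fps_X ^ (2 * b) * chain_gf t (y * Q) (b + t)"
proof -
  define c where "c n = chain_gf t (y * Q) (b + t * n)" for n
  define e where "e n = chain_gf t y (b + t * n)" for n
  define \<alpha> :: "nat \<Rightarrow> 'a fps" where "\<alpha> n = fps_X ^ (2 * (b + t * n))" for n
  define d where "d n = c n - y * \<alpha> n * Q * c (Suc n)" for n
  have \<alpha>: "\<alpha> (Suc n) = \<alpha> n * Q" for n
    by (simp add: \<alpha>_def Q_def power_add[symmetric] algebra_simps)
  have c: "c n = (1 + \<alpha> n) * c (Suc n) - y * Q * (\<alpha> n * Q) * c (Suc (Suc n))" for n
    using chain_gf_rec[OF assms(1), of "y * Q" "b + t * n"]
    unfolding \<alpha>[symmetric] by (simp add: c_def \<alpha>_def add_ac mult_2)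
  have e: "e n = (1 + \<alpha> n) * e (Suc n) - y * (\<alpha> n * Q) * e (Suc (Suc n))" for n
    using chain_gf_rec[OF assms(1), of y "b + t * n"]
    unfolding \<alpha>[symmetric] by (simp add: e_def \<alpha>_def add_ac mult_2)
  \<comment> \<open>By \<open>c\<close>, the second right-hand side is the first one taken at the
    next chain element. Both claims thus become \<open>e n = d n\<close>, at \<open>n = 0\<close>
    and at \<open>n = 1\<close>.\<close>
  have d1: "d (Suc n) = c n - \<alpha> n * c (Suc n)" for n
    by (simp add: d_def c[of n] \<alpha> algebra_simps)
  have d: "d n = (1 + \<alpha> n) * d (Suc n) - y * (\<alpha> n * Q) * d (Suc (Suc n))" for n
    unfolding d1 by (simp add: d_def c[of n] \<alpha> algebra_simps)
  have "d n - e n = 0" for n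
  proof (rule two_step_recurrence_eq_0[where D = "\<lambda>n. d n - e n"])
    show "d n - e n = (1 + \<alpha> n) * (d (Suc n) - e (Suc n))
        + (- (y * (\<alpha> n * Q))) * (d (Suc (Suc n)) - e (Suc (Suc n)))" for n
      by (subst d, subst e) (simp add: algebra_simps)
    show "fps_X ^ n dvd d n - e n" for n
    proof -
      have n: "n \<le> t * n" "n \<le> b + t * n"
        using assms(1) by (cases t; simp)+
      then have "fps_X ^ n dvd c n - 1" "fps_X ^ n dvd e n - 1"
        by (auto simp: c_def e_def intro: chain_gf_dvd_one)
      then have "fps_X ^ n dvd c n - e n"
        using dvd_diff_trans dvd_diff_sym by blast
      moreover have "fps_X ^ n dvd \<alpha> n"
        unfolding \<alpha>_def using n by (intro le_imp_power_dvd) auto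
      ultimately have "fps_X ^ n dvd (c n - e n) - \<alpha> n * (y * Q * c (Suc n))"
        by (rule dvd_diff[OF _ dvd_mult2])
      moreover have "d n - e n = (c n - e n) - \<alpha> n * (y * Q * c (Suc n))"
        by (simp add: d_def algebra_simps)
      ultimately show ?thesis by (simp only:)
    qed
  qed
  then have de: "e n = d n" for n by simp
  show "chain_gf t y b =
      chain_gf t (y * Q) b - y * fps_X ^ (2 * b) * Q * chain_gf t (y * Q) (b + t)"
    using de[of 0] by (simp add: e_def d_def c_def \<alpha>_def)
  show "chain_gf t y (b + t) =
      chain_gf t (y * Q) b - fps_X ^ (2 * b) * chain_gf t (y * Q) (b + t)"
    using de[of 1] d1[of 0] by (simp add: e_def c_def \<alpha>_def)
qed

section \<open>Product formulas for chains\<close>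

text \<open>At \<open>y = 0\<close> the recurrence loses its last term and becomes
  first-order.\<close>

lemma chain_gf_0_product:
  fixes b t :: nat
  assumes "t \<ge> 1" "b \<ge> 1"
  shows "chain_gf t 0 b = (qpoch (- (fps_X ^ (2 * b))) (fps_X ^ (2 * t)) :: 'a::idom fps)"
proof -
  define F where "F n = (chain_gf t 0 (b + t * n) :: 'a fps)" for n
  have "F 0 = 1 * qpoch (- (fps_X ^ (2 * b))) (fps_X ^ (2 * t))"
  proof (rule qpoch_eqI)
    show "F n = (1 - (- (fps_X ^ (2 * b))) * (fps_X ^ (2 * t)) ^ n) * F (Suc n)" for n
      using chain_gf_rec[OF assms(1), of 0 "b + t * n"]
      by (simp add: F_def power_mult[symmetric] power_add[symmetric] algebra_simps)
    show "fps_X ^ n dvd F n - 1" for n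
      unfolding F_def using assms by (intro chain_gf_dvd_one) (cases t; simp)
  qed (use assms in \<open>auto simp: fps_X_power_iff\<close>)
  then show ?thesis
    by (simp add: F_def)
qed

text \<open>Two scalings of \<open>y\<close> by \<open>fps_X ^ (2 * t)\<close> reproduce
  \<open>full_chain_gf\<close> up to one factor; hence the base \<open>fps_X ^ (4 * t)\<close> of
  the product.\<close>

lemma full_chain_gf_product:
  fixes y :: "'a::idom fps"
  assumes "t \<ge> 1"
  shows "full_chain_gf t y t =
    full_chain_gf t 0 t * qpoch (y * fps_X ^ (2 * t)) (fps_X ^ (4 * t))"
proof -
  define Q where "Q = (fps_X :: 'a fps) ^ (2 * t)"
  define F where "F n = full_chain_gf t (y * (Q ^ 2) ^ n) t" for n
  \<comment> \<open>For the chain from \<open>t\<close>, the coefficient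
    \<open>fps_X ^ (2 * b)\<close> is \<open>Q\<close>. The terms at \<open>t + t\<close> therefore
    cancel and leave \<open>(1 - y * Q) * chain_gf t (y * Q) t\<close>, whose second factor, scaled
    once more, is \<open>full_chain_gf t (y * Q ^ 2) t\<close>.\<close>
  have step: "full_chain_gf t y t = (1 - y * Q) * full_chain_gf t (y * Q ^ 2) t" for y
  proof -
    have "full_chain_gf t y t = chain_gf t y t - y * Q * chain_gf t y (t + t)"
      using full_chain_gf_eq[OF assms] by (simp add: Q_def)
    moreover have "chain_gf t y t = chain_gf t (y * Q) t - y * Q * Q * chain_gf t (y * Q) (t + t)"
      using chain_gf_scale(1)[OF assms, of y t] by (simp add: Q_def)
    moreover have "chain_gf t y (t + t) = chain_gf t (y * Q) t - Q * chain_gf t (y * Q) (t + t)"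
      using chain_gf_scale(2)[OF assms, of y t] by (simp add: Q_def)
    moreover have "full_chain_gf t (y * Q ^ 2) t =
        chain_gf t (y * Q ^ 2) t - y * Q ^ 2 * Q * chain_gf t (y * Q ^ 2) (t + t)"
      using full_chain_gf_eq[OF assms, of "y * Q ^ 2"] by (simp add: Q_def)
    moreover have "chain_gf t (y * Q) t =
        chain_gf t (y * Q ^ 2) t - y * Q * Q * Q * chain_gf t (y * Q ^ 2) (t + t)"
      using chain_gf_scale(1)[OF assms, of "y * Q" t]
      by (simp add: Q_def power2_eq_square mult.assoc)
    ultimately show ?thesis
      by algebra
  qed
  have "F 0 = full_chain_gf t 0 t * qpoch (y * Q) (Q ^ 2)"
  proof (rule qpoch_eqI)
    show "F n = (1 - y * Q * (Q\<^sup>2) ^ n) * F (Suc n)" for n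
      unfolding F_def by (subst step) (simp add: mult_ac)
    show "fps_X ^ n dvd F n - full_chain_gf t 0 t" for n
    proof -
      have "fps_X ^ n dvd (Q ^ 2) ^ n"
        unfolding Q_def power_mult[symmetric] using assms by (intro le_imp_power_dvd) (cases t; simp)
      then show ?thesis
        unfolding F_def by (intro chain_gf_cong_dvd) simp
    qed
  qed (use assms in \<open>auto simp: Q_def fps_X_power_iff power_mult[symmetric]\<close>)
  then show ?thesis
    by (simp add: F_def Q_def power_mult[symmetric])
qed

text \<open>In \<open>subset_gf_class_pair\<close> the left side turns out to be the generating
  function of one class. A single scaling of \<open>y\<close> already reproduces it up to a
  factor.\<close>

lemma chain_gf_pair_product:
  fixes y :: "'a::idom fps"
  assumes t: "r + s = t" "t \<ge> 1"
  shows "chain_gf t y r * chain_gf t y s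
      - y * fps_X ^ (2 * t) * chain_gf t y (r + t) * chain_gf t y (s + t) =
    chain_gf t 0 r * chain_gf t 0 s * qpoch (y * fps_X ^ (2 * t)) (fps_X ^ (2 * t))"
proof -
  define Q where "Q = (fps_X :: 'a fps) ^ (2 * t)"
  define G where "G y = chain_gf t y r * chain_gf t y s
      - y * Q * chain_gf t y (r + t) * chain_gf t y (s + t)" for y
  define F where "F n = G (y * Q ^ n)" for n
  have step: "G y = (1 - y * Q) * G (y * Q)" for y
  proof -
    define \<alpha> \<beta> :: "'a fps" where "\<alpha> = fps_X ^ (2 * r)" and "\<beta> = fps_X ^ (2 * s)"
    have Q: "Q = \<alpha> * \<beta>"
      by (simp add: \<alpha>_def \<beta>_def Q_def t(1)[symmetric] power_add[symmetric])
    have eqs: "chain_gf t y r = chain_gf t (y * Q) r - y * \<alpha> * Q * chain_gf t (y * Q) (r + t)"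
      "chain_gf t y (r + t) = chain_gf t (y * Q) r - \<alpha> * chain_gf t (y * Q) (r + t)"
      "chain_gf t y s = chain_gf t (y * Q) s - y * \<beta> * Q * chain_gf t (y * Q) (s + t)"
      "chain_gf t y (s + t) = chain_gf t (y * Q) s - \<beta> * chain_gf t (y * Q) (s + t)"
      using chain_gf_scale[OF t(2), of y] by (simp_all add: Q_def \<alpha>_def \<beta>_def)
    \<comment> \<open>The mixed products of \<open>c0\<close> with \<open>d1\<close> and of
      \<open>c1\<close> with \<open>d0\<close> cancel; \<open>Q = \<alpha> * \<beta>\<close> lets
      \<open>1 - y * Q\<close> be split off from the rest.\<close>
    have "(c0 - y * \<alpha> * Q * c1) * (d0 - y * \<beta> * Q * d1) -
        y * Q * (c0 - \<alpha> * c1) * (d0 - \<beta> * d1) =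
        (1 - y * Q) * (c0 * d0 - y * Q * Q * c1 * d1)" for c0 c1 d0 d1
      unfolding Q by (simp add: algebra_simps)
    then show ?thesis
      unfolding G_def eqs .
  qed
  have "F 0 = G 0 * qpoch (y * Q) Q"
  proof (rule qpoch_eqI)
    show "F n = (1 - y * Q * Q ^ n) * F (Suc n)" for n
      unfolding F_def by (subst step) (simp add: mult_ac)
    show "fps_X ^ n dvd F n - G 0" for n
    proof -
      have "fps_X ^ n dvd Q ^ n"
        unfolding Q_def power_mult[symmetric] using t by (intro le_imp_power_dvd) (cases t; simp)
      then have "fps_X ^ n dvd y * Q ^ n - 0" by simp
      then have "fps_X ^ n dvd G (y * Q ^ n) - G 0"
        unfolding G_def by (intro dvd_diff_diff dvd_diff_mult chain_gf_cong_dvd) auto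
      then show ?thesis by (simp add: F_def)
    qed
  qed (use t in \<open>auto simp: Q_def fps_X_power_iff\<close>)
  then show ?thesis
    by (simp add: F_def G_def Q_def)
qed

text \<open>As functions of \<open>s\<close>, the values at \<open>r\<close> and
  \<open>r + t\<close> correspond to the even and the odd part of the infinite product. Both pairs
  obey the same system linking \<open>s\<close> with \<open>s * fps_X ^ t\<close>, and they agree in
  the limit \<open>s = 0\<close>.\<close>

lemma chain_gf_half_product:
  fixes s :: "'a::idom fps"
  assumes t: "t = 2 * r" "r \<ge> 1"
  shows "2 * chain_gf t (s ^ 2) r =
    chain_gf t 0 r * (qpoch (- (s * fps_X ^ t)) (- (fps_X ^ t)) + qpoch (s * fps_X ^ t) (- (fps_X ^ t)))"
proof -
  define z where "z = (fps_X :: 'a fps) ^ t"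
  define e where "e \<sigma> = qpoch (- (\<sigma> * z)) (- z)" for \<sigma>
  define P where "P = (chain_gf t 0 r :: 'a fps)"
  \<comment> \<open>\<open>D1\<close> is the defect of the claim, for the even part;
    \<open>D2\<close> is the defect for the odd part and closes the system
    \<open>rec\<close>.\<close>
  define D1 where "D1 \<sigma> = P * (e \<sigma> + e (- \<sigma>)) - 2 * chain_gf t (\<sigma> ^ 2) r" for \<sigma>
  define D2 where "D2 \<sigma> = P * (e \<sigma> - e (- \<sigma>)) - 2 * \<sigma> * z * chain_gf t (\<sigma> ^ 2) (r + t)" for \<sigma>
  have z0: "z $ 0 = 0"
    using t by (simp add: z_def fps_X_power_iff)
  have e: "e \<sigma> = (1 + \<sigma> * z) * e (- (\<sigma> * z))" for \<sigma>
    using qpoch_unfold[of "- (\<sigma> * z)" "- z"] z0 by (simp add: e_def)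
  have Q: "fps_X ^ (2 * t) = z ^ 2"
    by (simp add: z_def power_mult[symmetric] mult.commute)
  have \<alpha>: "fps_X ^ (2 * r) = z"
    by (simp add: z_def t)
  have m: "chain_gf t (\<sigma> ^ 2) r =
      chain_gf t ((\<sigma> * z) ^ 2) r - \<sigma> ^ 2 * z * z ^ 2 * chain_gf t ((\<sigma> * z) ^ 2) (r + t)"
    "chain_gf t (\<sigma> ^ 2) (r + t) =
      chain_gf t ((\<sigma> * z) ^ 2) r - z * chain_gf t ((\<sigma> * z) ^ 2) (r + t)" for \<sigma>
    using chain_gf_scale[of t "\<sigma> ^ 2" r] t(2) t(1)
    unfolding Q \<alpha> power_mult_distrib by simp_all
  have e': "e (- \<sigma>) = (1 - \<sigma> * z) * e (\<sigma> * z)" for \<sigma>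
    using e[of "- \<sigma>"] by simp
  have rec: "D1 \<sigma> = D1 (\<sigma> * z) - \<sigma> * z * D2 (\<sigma> * z)"
    "D2 \<sigma> = \<sigma> * z * D1 (\<sigma> * z) - D2 (\<sigma> * z)" for \<sigma>
    unfolding D1_def D2_def m[of \<sigma>] e[of \<sigma>] e'[of \<sigma>]
    by (simp_all add: algebra_simps power2_eq_square)
  \<comment> \<open>At \<open>\<sigma> = 0\<close> both values of \<open>e\<close> are 1 and
    \<open>chain_gf\<close> equals \<open>P\<close>, so both defects vanish. This is the congruence
    version.\<close>
  have small: "fps_X ^ n dvd D1 \<sigma> \<and> fps_X ^ n dvd D2 \<sigma>" if "fps_X ^ n dvd \<sigma>" for n \<sigma>
  proof -
    have e1: "fps_X ^ n dvd e \<sigma> - 1" if "fps_X ^ n dvd \<sigma>" for \<sigma>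
      unfolding e_def using that z0 by (intro qpoch_dvd_one) auto
    have 1: "fps_X ^ n dvd e \<sigma> - 1" "fps_X ^ n dvd e (- \<sigma>) - 1"
      using that by (auto intro: e1)
    have "fps_X ^ n dvd chain_gf t (\<sigma> ^ 2) r - P"
      unfolding P_def using that by (intro chain_gf_cong_dvd) (simp add: power2_eq_square)
    moreover have "D1 \<sigma> = P * ((e \<sigma> - 1) + (e (- \<sigma>) - 1)) - 2 * (chain_gf t (\<sigma> ^ 2) r - P)"
      by (simp add: D1_def algebra_simps)
    ultimately have "fps_X ^ n dvd D1 \<sigma>"
      using 1 by (simp only: dvd_diff dvd_add dvd_mult)
    moreover have "D2 \<sigma> = P * ((e \<sigma> - 1) - (e (- \<sigma>) - 1)) - \<sigma> * (2 * z * chain_gf t (\<sigma> ^ 2) (r + t))"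
      by (simp add: D2_def algebra_simps)
    then have "fps_X ^ n dvd D2 \<sigma>"
      using 1 that by (simp only: dvd_diff dvd_mult dvd_mult2)
    ultimately show ?thesis ..
  qed
  have "fps_X ^ n dvd D1 \<sigma> \<and> fps_X ^ n dvd D2 \<sigma>" for n \<sigma>
  proof -
    \<comment> \<open>Downward induction: \<open>small\<close> applies at \<open>k = n\<close>,
      because \<open>fps_X\<close> divides \<open>z\<close>, and \<open>rec\<close> carries
      divisibility from \<open>Suc k\<close> to \<open>k\<close>.\<close>
    have "fps_X ^ n dvd D1 (\<sigma> * z ^ k) \<and> fps_X ^ n dvd D2 (\<sigma> * z ^ k)" if "k \<le> n" for k
      using that
    proof (induction k rule: inc_induct)
      case base
      have "fps_X ^ n dvd z ^ n"
        unfolding z_def power_mult[symmetric] using t by (intro le_imp_power_dvd) simp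
      then show ?case by (intro small) simp
    next
      case (step k)
      then show ?case
        using rec[of "\<sigma> * z ^ k"] by (simp add: mult_ac)
    qed
    from this[of 0] show ?thesis by simp
  qed
  then have "D1 s = 0"
    by (intro fps_eqI_dvd) simp
  then show ?thesis
    by (simp add: D1_def e_def P_def z_def)
qed

subsection \<open>Bars and residue classes\<close>

text \<open>A bar of length \<open>t\<close> is removed from a strict partition by lowering a part
  by \<open>t\<close>, which deletes it if it equals \<open>t\<close> (0 is never a part), or by
  deleting two parts with sum \<open>t\<close>, as in \<open>bar_pairs\<close>.\<close>

definition bars :: "nat \<Rightarrow> nat set \<Rightarrow> nat set" where
  "bars t S = {a \<in> S. t \<le> a \<and> a - t \<notin> S}"

definition bar_pairs :: "nat \<Rightarrow> nat set \<Rightarrow> (nat \<times> nat) set" where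
  "bar_pairs t S = {(a, b) \<in> S \<times> S. a < b \<and> a + b = t}"

definition bar_count :: "nat \<Rightarrow> nat set \<Rightarrow> nat" where
  "bar_count t S = card (bars t S) + card (bar_pairs t S)"

text \<open>The representative of the class of \<open>a\<close> and \<open>-a\<close> modulo
  \<open>t\<close> that lies between 0 and \<open>t div 2\<close>.\<close>

definition residue_class :: "nat \<Rightarrow> nat \<Rightarrow> nat" where
  "residue_class t a = min (a mod t) (t - a mod t)"

definition class_set :: "nat \<Rightarrow> nat \<Rightarrow> nat set" where
  "class_set t i = {a. 0 < a \<and> residue_class t a = i}"

lemma residue_class_minus: "t \<le> a \<Longrightarrow> residue_class t (a - t) = residue_class t a"
  by (simp add: residue_class_def le_mod_geq)

lemma residue_class_complement:
  assumes "a + b = t" "0 < a" "0 < b"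
  shows "residue_class t a = residue_class t b"
proof -
  have "a < t" "b < t" "t - a = b" "t - b = a" using assms by auto
  then show ?thesis
    by (simp add: residue_class_def min.commute)
qed

lemma finite_bars: "finite S \<Longrightarrow> finite (bars t S)"
  by (simp add: bars_def)

lemma finite_bar_pairs: "finite S \<Longrightarrow> finite (bar_pairs t S)"
  by (rule finite_subset[of _ "S \<times> S"]) (auto simp: bar_pairs_def)

text \<open>Both \<open>a, a - t\<close> and two parts with sum \<open>t\<close> lie in a common
  class, so no bar of the union involves both sets.\<close>

lemma bar_count_union:
  assumes "finite S" "finite T" "0 \<notin> S" "0 \<notin> T"
    and sep: "\<And>a b. a \<in> S \<Longrightarrow> b \<in> T \<Longrightarrow> residue_class t a \<noteq> residue_class t b"
  shows "bar_count t (S \<union> T) = bar_count t S + bar_count t T"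
proof -
  have disj: "S \<inter> T = {}" using sep by auto
  have "a - t \<notin> T" if "a \<in> S" "t \<le> a" for a
    using sep[OF that(1)] residue_class_minus[OF that(2)] by metis
  moreover have "b - t \<notin> S" if "b \<in> T" "t \<le> b" for b
    using sep[OF _ that(1)] residue_class_minus[OF that(2)] by metis
  ultimately have "bars t (S \<union> T) = bars t S \<union> bars t T"
    by (auto simp: bars_def)
  moreover have "bars t S \<inter> bars t T = {}"
    using disj by (auto simp: bars_def)
  moreover have "a + b \<noteq> t" if "a \<in> S" "b \<in> T" for a b
    using sep[OF that] residue_class_complement[of a b t] assms(3,4) that by (metis gr0I)
  then have "bar_pairs t (S \<union> T) = bar_pairs t S \<union> bar_pairs t T"
    by (fastforce simp: bar_pairs_def add.commute)
  moreover have "bar_pairs t S \<inter> bar_pairs t T = {}"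
    using disj by (auto simp: bar_pairs_def)
  ultimately show ?thesis
    using assms(1,2) by (simp add: bar_count_def card_Un_disjoint finite_bars finite_bar_pairs)
qed

text \<open>Stated for a general weight because it serves twice: for the bar statistic, and for the
  constant weight 1, whose factors recombine to the product at \<open>y = 0\<close>.\<close>

lemma subset_gf_classes:
  fixes f :: "nat set \<Rightarrow> 'a::comm_ring_1 fps"
  assumes "t \<ge> 1" "f {} = 1"
    and mult: "\<And>S T. finite S \<Longrightarrow> finite T \<Longrightarrow> 0 \<notin> S \<Longrightarrow> 0 \<notin> T \<Longrightarrow>
      (\<And>a b. a \<in> S \<Longrightarrow> b \<in> T \<Longrightarrow> residue_class t a \<noteq> residue_class t b) \<Longrightarrow> f (S \<union> T) = f S * f T"
  shows "subset_gf f {0<..} = (\<Prod>i\<le>t div 2. subset_gf f (class_set t i))"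
proof -
  have "residue_class t a \<le> t div 2" for a
    by (simp add: residue_class_def min_def) linarith
  then have "{0<..} = (\<Union>i\<in>{..t div 2}. class_set t i)"
    by (auto simp: class_set_def)
  moreover have "subset_gf f (\<Union>i\<in>{..t div 2}. class_set t i) =
      (\<Prod>i\<le>t div 2. subset_gf f (class_set t i))"
  proof (rule subset_gf_UN)
    fix i J S T
    assume "J \<subseteq> {..t div 2} - {i}" "finite S" "S \<subseteq> class_set t i" "finite T"
      "T \<subseteq> (\<Union>j\<in>J. class_set t j)"
    then have "residue_class t a = i" "residue_class t b \<noteq> i" if "a \<in> S" "b \<in> T" for a b
      using that by (fastforce simp: class_set_def)+
    moreover have "0 \<notin> S" "0 \<notin> T"
      using \<open>S \<subseteq> class_set t i\<close> \<open>T \<subseteq> (\<Union>j\<in>J. class_set t j)\<close> by (auto simp: class_set_def)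
    ultimately show "f (S \<union> T) = f S * f T"
      using \<open>finite S\<close> \<open>finite T\<close> by (intro mult) auto
  qed (use assms(2) in \<open>auto simp: class_set_def\<close>)
  ultimately show ?thesis by simp
qed

lemma mem_chain_iff:
  assumes "r < t"
  shows "a \<in> chain t r \<longleftrightarrow> a mod t = r"
proof
  assume "a mod t = r"
  then have "a = r + t * (a div t)"
    using mod_mult_div_eq[of a t] by simp
  then show "a \<in> chain t r"
    unfolding chain_def by (rule range_eqI)
qed (use assms in \<open>auto simp: chain_def\<close>)

lemma class_set_0:
  assumes "t \<ge> 1"
  shows "class_set t 0 = chain t t"
proof -
  have "residue_class t a = 0 \<longleftrightarrow> a mod t = 0" for a
  proof -
    have "a mod t < t"
      using assms by simp
    then show ?thesis
      by (auto simp: residue_class_def min_def)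
  qed
  then have "class_set t 0 = chain t 0 - {0}"
    using assms mem_chain_iff[of 0 t] by (auto simp: class_set_def)
  also have "\<dots> = chain t t"
    using chain_unfold[of t 0] chain_ge[of 0 t t] assms by auto
  finally show ?thesis .
qed

text \<open>For \<open>2 * i = t\<close> the two chains coincide; this makes the middle class of an
  even \<open>t\<close> exceptional.\<close>

lemma class_set_pair:
  assumes "1 \<le> i" "2 * i \<le> t"
  shows "class_set t i = chain t i \<union> chain t (t - i)"
proof -
  have "a \<in> class_set t i \<longleftrightarrow> a mod t = i \<or> a mod t = t - i" for a
    using assms mod_less_divisor[of t a]
    by (cases "a = 0") (auto simp: class_set_def residue_class_def min_def)
  then show ?thesis
    using assms mem_chain_iff[of i t] mem_chain_iff[of "t - i" t] by (intro set_eqI) simp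
qed

lemma bars_chain:
  assumes "t \<ge> 1" "S \<subseteq> chain t r" "r < t"
  shows "bars t S = starts t S - {r}"
proof -
  have "t \<le> a \<longleftrightarrow> a \<noteq> r" if "a \<in> S" for a
  proof (cases "a = r")
    case False
    then have "a \<in> chain t (r + t)"
      using that assms(2) chain_unfold[of t r] by blast
    then show ?thesis
      using False chain_ge[of a t "r + t"] by simp
  qed (use assms(3) in simp)
  then show ?thesis
    unfolding bars_def starts_def using not_le by blast
qed

section \<open>Generating functions of the residue classes\<close>

text \<open>All elements are at least \<open>t\<close>, so no two sum to \<open>t\<close>. The
  element \<open>t\<close> itself can carry a bar, as 0 is absent; hence the full version.\<close>

lemma subset_gf_class_0:
  assumes "t \<ge> 1"
  shows "subset_gf (\<lambda>S. (1 - y) ^ bar_count t S) (class_set t 0) = full_chain_gf t y t"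
  unfolding full_chain_gf_def class_set_0[OF assms]
proof (rule subset_gf_cong)
  fix S assume "S \<subseteq> chain t t"
  then have S: "t \<le> a" if "a \<in> S" for a
    using that chain_ge by blast
  then have "bars t S = starts t S"
    by (force simp: bars_def starts_def)
  moreover have "bar_pairs t S = {}"
    using S assms by (fastforce simp: bar_pairs_def)
  ultimately show "(1 - y) ^ bar_count t S = (1 - y) ^ card (starts t S)"
    by (simp add: bar_count_def)
qed

text \<open>Two distinct elements that are at least \<open>r\<close> cannot sum to
  \<open>2 * r\<close>, so only \<open>bars\<close> counts.\<close>

lemma subset_gf_class_half:
  assumes "r \<ge> 1"
  shows "subset_gf (\<lambda>S. (1 - y) ^ bar_count (2 * r) S) (class_set (2 * r) r) = chain_gf (2 * r) y r"
proof -
  have "class_set (2 * r) r = chain (2 * r) r"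
    using class_set_pair[of r "2 * r"] assms by simp
  moreover have "subset_gf (\<lambda>S. (1 - y) ^ bar_count (2 * r) S) (chain (2 * r) r) = chain_gf (2 * r) y r"
    unfolding chain_gf_def
  proof (rule subset_gf_cong)
    fix S assume S: "S \<subseteq> chain (2 * r) r"
    then have "r \<le> a" if "a \<in> S" for a
      using that chain_ge by blast
    then have "bar_pairs (2 * r) S = {}"
      by (fastforce simp: bar_pairs_def)
    moreover have "bars (2 * r) S = starts (2 * r) S - {r}"
      using S assms by (intro bars_chain) auto
    ultimately show "(1 - y) ^ bar_count (2 * r) S = (1 - y) ^ card (starts (2 * r) S - {r})"
      by (simp add: bar_count_def)
  qed
  ultimately show ?thesis by simp
qed

text \<open>The only elements below \<open>t\<close> are \<open>r\<close> and \<open>s\<close>, so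
  \<open>(r, s)\<close> is the only possible pair with sum \<open>t\<close>.\<close>

lemma bar_count_pair:
  assumes "r + s = t" "1 \<le> r" "r < s" "finite S" "finite T" "S \<subseteq> chain t r" "T \<subseteq> chain t s"
  shows "bar_count t (S \<union> T) = card (starts t S - {r}) + card (starts t T - {s})
    + (if r \<in> S \<and> s \<in> T then 1 else 0)"
proof -
  have mod: "a mod t = r" if "a \<in> S" for a
    using that assms mem_chain_iff[of r t] by auto
  have mod': "a mod t = s" if "a \<in> T" for a
    using that assms mem_chain_iff[of s t] by auto
  have ge: "a = r \<or> a = s \<or> t \<le> a" if "a \<in> S \<union> T" for a
    using that mod mod' by (metis Un_iff mod_less not_le)
  have disj: "S \<inter> T = {}"
    using mod mod' assms(3) by fastforce
  have "(a - t) mod t = a mod t" if "t \<le> a" for a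
    using that by (simp add: le_mod_geq)
  then have "bars t (S \<union> T) = bars t S \<union> bars t T"
    using mod mod' assms(3) by (force simp: bars_def)
  also have "\<dots> = (starts t S - {r}) \<union> (starts t T - {s})"
    using assms by (subst (1 2) bars_chain) auto
  finally have "card (bars t (S \<union> T)) = card (starts t S - {r}) + card (starts t T - {s})"
    using assms(4,5) disj by (simp add: card_Un_disjoint finite_starts starts_def disjoint_iff)
  moreover have "bar_pairs t (S \<union> T) = (if r \<in> S \<and> s \<in> T then {(r, s)} else {})"
  proof -
    have "s \<notin> S" "r \<notin> T" "0 \<notin> S" "0 \<notin> T"
      using mod[of s] mod'[of r] mod[of 0] mod'[of 0] assms by auto
    moreover have "(a, b) \<in> bar_pairs t (S \<union> T) \<Longrightarrow> a = r \<and> b = s" for a b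
      using ge[of a] ge[of b] assms(1,3) calculation by (auto simp: bar_pairs_def)
    ultimately show ?thesis
      using assms(1,3) by (auto simp: bar_pairs_def)
  qed
  ultimately show ?thesis
    by (simp add: bar_count_def)
qed

text \<open>Split by membership of \<open>r\<close> and \<open>s\<close>. The two chains interact
  only through the pair \<open>(r, s)\<close>, which gives a further factor \<open>1 - y\<close>
  when both are present.\<close>

lemma subset_gf_class_pair:
  fixes y :: "'a::idom fps"
  assumes "1 \<le> r" "2 * r < t"
  shows "subset_gf (\<lambda>S. (1 - y) ^ bar_count t S) (class_set t r) =
    subset_gf (\<lambda>_. 1) (class_set t r) * qpoch (y * fps_X ^ (2 * t)) (fps_X ^ (2 * t))"
proof -
  define s where "s = t - r"
  have rs: "r + s = t" "r < s" "r < t" "s < t" "1 \<le> t" "1 \<le> s"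
    using assms by (auto simp: s_def)
  define A B where "A = chain t (r + t)" and "B = chain t (s + t)"
  define W where "W S = (1 - y) ^ bar_count t S" for S
  define P where "P b S = (1 - y) ^ card (starts t S - {b})" for b S
  define F where "F S = (1 - y) ^ card (starts t S)" for S
  have chains: "chain t r = insert r A" "chain t s = insert s B"
    unfolding A_def B_def by (rule chain_unfold)+
  have notin: "r \<notin> A" "s \<notin> B" "r \<notin> B" "s \<notin> A"
    using rs by (auto simp: A_def B_def dest!: chain_ge)
  have disj: "chain t r \<inter> chain t s = {}"
    using rs by (auto simp: mem_chain_iff)
  then have disjAB: "A \<inter> B = {}"
    by (auto simp: chains)
  have cls: "class_set t r = chain t r \<union> chain t s"
    unfolding s_def using assms by (intro class_set_pair) auto
  have st: "starts t S - {r} = starts t S" "starts t (insert r S) - {r} = starts t S - {r + t}"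
    if "S \<subseteq> A" for S
    using that starts_insert[of t S r] notin(1) rs(5) unfolding A_def starts_def by blast+
  have st': "starts t S - {s} = starts t S" "starts t (insert s S) - {s} = starts t S - {s + t}"
    if "S \<subseteq> B" for S
    using that starts_insert[of t S s] notin(2) rs(5) unfolding B_def starts_def by blast+
  have W: "W (S \<union> T) = P r S * P s T * (if r \<in> S \<and> s \<in> T then 1 - y else 1)"
    if "finite S" "finite T" "S \<subseteq> insert r A" "T \<subseteq> insert s B" for S T
    using bar_count_pair[of r s t S T] that assms rs by (simp add: W_def P_def power_add chains)
  have 1: "subset_gf W (A \<union> B) = subset_gf F A * subset_gf F B"
  proof (rule subset_gf_union[OF disjAB])
    fix S T assume "finite S" "S \<subseteq> A" "finite T" "T \<subseteq> B"
    moreover from this have "r \<notin> S" "s \<notin> S" "r \<notin> T" "s \<notin> T"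
      using notin by auto
    ultimately show "W (S \<union> T) = F S * F T"
      using W[of S T] st[of S] st'[of T] rs(2)
      by (simp add: subset_insertI2 P_def F_def)
  qed
  have 2: "subset_gf (\<lambda>U. W (insert r U)) (A \<union> B) = subset_gf (P (r + t)) A * subset_gf F B"
  proof (rule subset_gf_union[OF disjAB])
    fix S T assume "finite S" "S \<subseteq> A" "finite T" "T \<subseteq> B"
    moreover from this have "r \<notin> S" "s \<notin> S" "r \<notin> T" "s \<notin> T"
      using notin by auto
    ultimately show "W (insert r (S \<union> T)) = P (r + t) S * F T"
      using W[of "insert r S" T] st[of S] st'[of T] rs(2)
      by (simp add: subset_insertI2 P_def F_def)
  qed
  have 3: "subset_gf (\<lambda>U. W (insert s U)) (A \<union> B) = subset_gf F A * subset_gf (P (s + t)) B"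
  proof (rule subset_gf_union[OF disjAB])
    fix S T assume "finite S" "S \<subseteq> A" "finite T" "T \<subseteq> B"
    moreover from this have "r \<notin> S" "s \<notin> S" "r \<notin> T" "s \<notin> T"
      using notin by auto
    ultimately show "W (insert s (S \<union> T)) = F S * P (s + t) T"
      using W[of S "insert s T"] st[of S] st'[of T] rs(2)
      by (simp add: subset_insertI2 P_def F_def)
  qed
  have 4: "subset_gf (\<lambda>U. W (insert r (insert s U))) (A \<union> B) =
      subset_gf (\<lambda>S. (1 - y) * P (r + t) S) A * subset_gf (P (s + t)) B"
  proof (rule subset_gf_union[OF disjAB])
    fix S T assume "finite S" "S \<subseteq> A" "finite T" "T \<subseteq> B"
    moreover from this have "r \<notin> S" "s \<notin> S" "r \<notin> T" "s \<notin> T"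
      using notin by auto
    ultimately show "W (insert r (insert s (S \<union> T))) = (1 - y) * P (r + t) S * P (s + t) T"
      using W[of "insert r S" "insert s T"] st[of S] st'[of T] rs(2)
      by (simp add: subset_insertI2 P_def mult_ac insert_commute)
  qed
  have gfs: "subset_gf F A = full_chain_gf t y (r + t)" "subset_gf F B = full_chain_gf t y (s + t)"
    "subset_gf (P (r + t)) A = chain_gf t y (r + t)" "subset_gf (P (s + t)) B = chain_gf t y (s + t)"
    by (simp_all add: F_def[abs_def] P_def[abs_def] A_def B_def full_chain_gf_def chain_gf_def)
  have "class_set t r = insert r (insert s (A \<union> B))"
    by (auto simp: cls chains)
  moreover have "r \<notin> insert s (A \<union> B)" "s \<notin> A \<union> B"
    using notin rs by auto
  ultimately have "subset_gf W (class_set t r) =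
      subset_gf W (A \<union> B) + fps_X ^ (2 * s) * subset_gf (\<lambda>U. W (insert s U)) (A \<union> B)
      + fps_X ^ (2 * r) * (subset_gf (\<lambda>U. W (insert r U)) (A \<union> B)
        + fps_X ^ (2 * s) * subset_gf (\<lambda>U. W (insert r (insert s U))) (A \<union> B))"
    by (simp add: subset_gf_insert)
  \<comment> \<open>With independent chains the four terms would form the product of two
    \<open>chain_gf\<close>; the extra \<open>1 - y\<close> in the fourth term accounts for the
    correction with \<open>- y\<close>.\<close>
  also have "\<dots> = chain_gf t y r * chain_gf t y s
      - y * (fps_X ^ (2 * r) * fps_X ^ (2 * s)) * chain_gf t y (r + t) * chain_gf t y (s + t)"
    unfolding 1 2 3 4 subset_gf_cmult gfs chain_gf_split(1)[OF rs(5), of y r]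
      chain_gf_split(1)[OF rs(5), of y s] by (simp add: algebra_simps)
  also have "fps_X ^ (2 * r) * fps_X ^ (2 * s) = (fps_X ^ (2 * t) :: 'a fps)"
    by (simp add: rs(1)[symmetric] power_add[symmetric])
  also have "chain_gf t y r * chain_gf t y s
      - y * fps_X ^ (2 * t) * chain_gf t y (r + t) * chain_gf t y (s + t) =
      chain_gf t 0 r * chain_gf t 0 s * qpoch (y * fps_X ^ (2 * t)) (fps_X ^ (2 * t))"
    using rs by (intro chain_gf_pair_product) auto
  also have "chain_gf t 0 r * chain_gf t 0 s = (subset_gf (\<lambda>_. 1) (class_set t r) :: 'a fps)"
    unfolding cls chain_gf_0 by (rule subset_gf_union[symmetric]) (use disj in auto)
  finally show ?thesis
    unfolding W_def .
qed

text \<open>Class 0 yields the product with base \<open>fps_X ^ (4 * t)\<close>, each class strictly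
  between 0 and \<open>t / 2\<close> one copy of \<open>qpoch (y * Q) Q\<close>, and for even
  \<open>t\<close> the class \<open>t / 2\<close> the last bracket. The factor 2 stays on the left
  since 2 need not be invertible here.\<close>

lemma bar_gf_product:
  fixes y :: "'a::idom fps" and t :: nat
  assumes "t \<ge> 1"
  defines "Q \<equiv> fps_X ^ (2 * t)" and "F \<equiv> subset_gf (\<lambda>S. (1 - y) ^ bar_count t S) {0<..}"
  shows "odd t \<Longrightarrow> F = qpoch (- (fps_X ^ 2)) (fps_X ^ 2) * qpoch (y * Q) Q ^ ((t - 1) div 2)
      * qpoch (y * Q) (fps_X ^ (4 * t))"
    and "even t \<Longrightarrow> y = s ^ 2 \<Longrightarrow>
      2 * F = qpoch (- (fps_X ^ 2)) (fps_X ^ 2) * qpoch (y * Q) Q ^ ((t - 2) div 2)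
        * qpoch (y * Q) (fps_X ^ (4 * t))
        * (qpoch (- (s * fps_X ^ t)) (- (fps_X ^ t)) + qpoch (s * fps_X ^ t) (- (fps_X ^ t)))"
proof -
  define W where "W S = (1 - y) ^ bar_count t S" for S
  define one where "one = (\<lambda>_ :: nat set. 1 :: 'a fps)"
  define R where "R = qpoch (y * Q) Q"
  define Z where "Z = qpoch (y * Q) (fps_X ^ (4 * t))"
  have F: "F = (\<Prod>i\<le>t div 2. subset_gf W (class_set t i))"
    unfolding F_def W_def using assms(1)
    by (intro subset_gf_classes)
      (simp_all add: bar_count_union power_add, simp add: bar_count_def bars_def bar_pairs_def)
  \<comment> \<open>All positive integers form a chain with step 1, so
    \<open>chain_gf_0_product\<close> evaluates the unweighted series.\<close>
  have "{0<..} = chain 1 1"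
    by (auto simp: chain_def image_def gr0_conv_Suc)
  then have "qpoch (- (fps_X ^ 2)) (fps_X ^ 2) = subset_gf one {0<..}"
    using chain_gf_0_product[of 1 1, where ?'a = 'a] chain_gf_0(1)[of 1 1, where ?'a = 'a]
    by (simp add: one_def)
  also have "\<dots> = (\<Prod>i\<le>t div 2. subset_gf one (class_set t i))"
    using assms(1) by (intro subset_gf_classes) (auto simp: one_def)
  finally have P: "qpoch (- (fps_X ^ 2)) (fps_X ^ 2) = (\<Prod>i\<le>t div 2. subset_gf one (class_set t i))" .
  have 0: "subset_gf W (class_set t 0) = subset_gf one (class_set t 0) * Z"
    using subset_gf_class_0[OF assms(1), of y] full_chain_gf_product[OF assms(1), of y]
      chain_gf_0(2)[of t t, where ?'b = 'a] class_set_0[OF assms(1)]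
    by (simp add: W_def[abs_def] one_def Z_def Q_def)
  have pair: "subset_gf W (class_set t i) = subset_gf one (class_set t i) * R"
    if "1 \<le> i" "2 * i < t" for i
    unfolding W_def one_def R_def Q_def using that by (rule subset_gf_class_pair)
  have pairs: "(\<Prod>i\<le>m. subset_gf W (class_set t i)) =
      (\<Prod>i\<le>m. subset_gf one (class_set t i)) * R ^ m * Z" if "2 * m < t" for m
    using that by (induction m) (simp_all add: 0 pair mult_ac)
  show "F = qpoch (- (fps_X ^ 2)) (fps_X ^ 2) * R ^ ((t - 1) div 2) * Z" if "odd t"
  proof -
    have "t div 2 = (t - 1) div 2" "2 * (t div 2) < t"
      using that by (auto elim!: oddE)
    then show ?thesis
      using pairs[of "t div 2"] unfolding F P by simp
  qed
  show "2 * F = qpoch (- (fps_X ^ 2)) (fps_X ^ 2) * R ^ ((t - 2) div 2) * Z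
        * (qpoch (- (s * fps_X ^ t)) (- (fps_X ^ t)) + qpoch (s * fps_X ^ t) (- (fps_X ^ t)))"
    if "even t" "y = s ^ 2"
  proof -
    from that(1) obtain k where "t = 2 * k"
      by (elim evenE)
    then obtain m where t: "t = 2 * Suc m"
      using assms(1) by (cases k) auto
    have m: "t div 2 = Suc m" "(t - 2) div 2 = m" "2 * m < t"
      by (auto simp: t)
    have "class_set t (Suc m) = chain t (Suc m)"
      using class_set_pair[of "Suc m" t] by (simp add: t)
    then have "2 * subset_gf W (class_set t (Suc m)) = subset_gf one (class_set t (Suc m))
        * (qpoch (- (s * fps_X ^ t)) (- (fps_X ^ t)) + qpoch (s * fps_X ^ t) (- (fps_X ^ t)))"
      using subset_gf_class_half[of "Suc m" y] chain_gf_half_product[of t "Suc m" s]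
        chain_gf_0(1)[of t "Suc m", where ?'a = 'a] that(2)
      by (simp add: W_def[abs_def] one_def t)
    moreover have "2 * F = (\<Prod>i\<le>m. subset_gf W (class_set t i)) * (2 * subset_gf W (class_set t (Suc m)))"
      unfolding F m by simp
    ultimately show ?thesis
      unfolding P m pairs[OF m(3)] by (simp add: mult_ac)
  qed
qed

subsection \<open>Hooks of doubled distinct partitions\<close>

lemma down_closed_eq_lessThan:
  fixes A :: "nat set"
  assumes "finite A" "\<And>i j. j \<in> A \<Longrightarrow> i \<le> j \<Longrightarrow> i \<in> A"
  shows "A = {..<card A}"
proof -
  have "{..<card A} \<subseteq> A"
  proof
    fix i assume "i \<in> {..<card A}"
    then have "\<not> A \<subseteq> {..<i}"
      using card_mono[of "{..<i}" A] by auto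
    then obtain a where "a \<in> A" "i \<le> a"
      by (meson lessThan_iff not_le subsetI)
    then show "i \<in> A"
      by (rule assms(2))
  qed
  then show ?thesis
    using assms(1) by (intro card_subset_eq[symmetric]) auto
qed

text \<open>Rows and first column are initial segments, whose sizes give the parts and their
  number.\<close>

lemma young_exists:
  assumes "finite Y"
    and down: "\<And>i j i' j'. (i, j) \<in> Y \<Longrightarrow> i' \<le> i \<Longrightarrow> j' \<le> j \<Longrightarrow> (i', j') \<in> Y"
  shows "\<exists>\<mu>. is_partition \<mu> \<and> young \<mu> = Y"
proof -
  define R where "R i = {j. (i, j) \<in> Y}" for i
  define C where "C = {i. (i, 0) \<in> Y}"
  have "R i \<subseteq> snd ` Y" for i
    by (force simp: R_def)
  then have "finite (R i)" for i
    by (rule finite_subset) (use assms(1) in simp)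
  moreover have "C \<subseteq> fst ` Y"
    by (force simp: C_def)
  then have "finite C"
    by (rule finite_subset) (use assms(1) in simp)
  ultimately have fin: "finite (R i)" "finite C" for i
    by blast+
  have R: "R i = {..<card (R i)}" for i
    by (rule down_closed_eq_lessThan[OF fin(1)]) (auto simp: R_def intro: down)
  have C: "C = {..<card C}"
    by (rule down_closed_eq_lessThan[OF fin(2)]) (auto simp: C_def intro: down)
  define \<mu> where "\<mu> = map (\<lambda>i. card (R i)) [0..<card C]"
  have "card (R i') \<le> card (R i)" if "i \<le> i'" for i i'
    using fin that by (intro card_mono) (auto simp: R_def intro: down)
  moreover have "0 < card (R i)" if "i < card C" for i
  proof -
    have "i \<in> C" using that C by auto
    then have "0 \<in> R i" by (simp add: R_def C_def)
    then show ?thesis using fin by (auto simp: card_gt_0_iff)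
  qed
  ultimately have "is_partition \<mu>"
    by (auto simp: is_partition_def \<mu>_def sorted_wrt_iff_nth_less)
  moreover have "(i, j) \<in> young \<mu> \<longleftrightarrow> (i, j) \<in> Y" for i j
  proof -
    have "(i, j) \<in> young \<mu> \<longleftrightarrow> i \<in> C \<and> j \<in> R i"
      using arg_cong[OF C, of "\<lambda>A. i \<in> A"] arg_cong[OF R[of i], of "\<lambda>A. j \<in> A"]
      by (auto simp: young_def \<mu>_def)
    also have "\<dots> \<longleftrightarrow> (i, j) \<in> Y"
      by (auto simp: C_def R_def intro: down)
    finally show ?thesis .
  qed
  ultimately show ?thesis by auto
qed

lemma young_row: "{j. (i, j) \<in> young \<mu>} = (if i < length \<mu> then {..<\<mu> ! i} else {})"
  by (auto simp: young_def)

lemma young_inj: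
  assumes "is_partition \<mu>" "is_partition \<mu>'" "young \<mu> = young \<mu>'"
  shows "\<mu> = \<mu>'"
proof -
  have len: "i < length \<mu> \<longleftrightarrow> (i, 0) \<in> young \<mu>" if "is_partition \<mu>" for i \<mu>
    using that by (auto simp: young_def is_partition_def)
  have "i < length \<mu> \<longleftrightarrow> i < length \<mu>'" for i
    using len assms by metis
  then have "length \<mu> = length \<mu>'"
    by (metis linorder_neqE_nat nat_less_le)
  moreover have "\<mu> ! i = \<mu>' ! i" if "i < length \<mu>" for i
    using young_row[of i \<mu>] young_row[of i \<mu>'] assms(3) that calculation by simp
  ultimately show ?thesis
    by (rule nth_equalityI)
qed

lemma card_young: "card (young \<mu>) = sum_list \<mu>"
proof -
  have "young \<mu> = (SIGMA i:{..<length \<mu>}. {..<\<mu> ! i})"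
    by (auto simp: young_def)
  then show ?thesis
    by (simp add: sum_list_sum_nth atLeast0LessThan)
qed

lemma finite_young: "finite (young \<mu>)"
proof -
  have "young \<mu> = (SIGMA i:{..<length \<mu>}. {..<\<mu> ! i})"
    by (auto simp: young_def)
  then show ?thesis by simp
qed

section \<open>Doubled diagrams and their hook lengths\<close>

text \<open>\<open>i + \<nu> ! i\<close> is the last column of row \<open>i\<close> in the doubled
  diagram. It decreases weakly because the parts decrease strictly, and at the last index it is at
  least \<open>length \<nu>\<close>.\<close>

lemma strict_partition_nth:
  assumes "is_strict_partition \<nu>" "i < length \<nu>"
  shows "i \<le> k \<Longrightarrow> k < length \<nu> \<Longrightarrow> k + \<nu> ! k \<le> i + \<nu> ! i"
    and "length \<nu> \<le> i + \<nu> ! i"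
    and "i < k \<Longrightarrow> k < length \<nu> \<Longrightarrow> \<nu> ! k < \<nu> ! i"
    and "0 < \<nu> ! i"
proof -
  have pos: "0 < \<nu> ! k" if "k < length \<nu>" for k
    using assms(1) that by (auto simp: is_strict_partition_def is_partition_def)
  have less: "\<nu> ! k < \<nu> ! i" if "i < k" "k < length \<nu>" for i k
  proof -
    have "\<nu> ! k \<le> \<nu> ! i"
      using assms(1) that sorted_wrt_nth_less[of "(\<ge>)" \<nu> i k]
      by (simp add: is_strict_partition_def is_partition_def)
    moreover have "\<nu> ! k \<noteq> \<nu> ! i"
      using assms(1) that by (simp add: is_strict_partition_def nth_eq_iff_index_eq)
    ultimately show ?thesis by simp
  qed
  have le: "k + \<nu> ! k \<le> i + \<nu> ! i" if "i \<le> k" "k < length \<nu>" for i k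
    using that
  proof (induction k rule: dec_induct)
    case (step k)
    then show ?case
      using less[of k "Suc k"] by simp
  qed simp
  show "0 < \<nu> ! i" by (rule pos) fact
  show "i \<le> k \<Longrightarrow> k < length \<nu> \<Longrightarrow> k + \<nu> ! k \<le> i + \<nu> ! i"
    by (rule le)
  show "i < k \<Longrightarrow> k < length \<nu> \<Longrightarrow> \<nu> ! k < \<nu> ! i"
    by (rule less)
  show "length \<nu> \<le> i + \<nu> ! i"
    using le[of i "length \<nu> - 1"] pos[of "length \<nu> - 1"] assms(2) by (cases "length \<nu>") auto
qed

lemma doubling_exists:
  assumes "is_strict_partition \<nu>"
  shows "\<exists>\<mu>. is_doubling \<nu> \<mu>"
proof -
  note nu = strict_partition_nth[OF assms]
  let ?Y = "shifted_diagram \<nu> \<union> added_boxes \<nu>"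
  have "shifted_diagram \<nu> \<subseteq> (SIGMA i:{..<length \<nu>}. {..i + \<nu> ! i})"
    "added_boxes \<nu> \<subseteq> (\<lambda>(j, i). (i, j)) ` (SIGMA j:{..<length \<nu>}. {..<j + \<nu> ! j})"
    by (auto simp: shifted_diagram_def added_boxes_def)
  then have "finite ?Y"
    by (auto intro: finite_subset)
  \<comment> \<open>If both boxes lie on the same side of the diagonal, monotonicity of
    \<open>i + \<nu> ! i\<close> suffices; if the move crosses it, the bound by
    \<open>length \<nu>\<close> does.\<close>
  moreover have "(i', j') \<in> ?Y" if "(i, j) \<in> ?Y" "i' \<le> i" "j' \<le> j" for i j i' j'
  proof (cases "i' < j'")
    case True
    have "i' < length \<nu> \<and> j' \<le> i' + \<nu> ! i'"
    proof (cases "i < j")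
      case True
      then have "i < length \<nu>" "j \<le> i + \<nu> ! i"
        using that(1) by (auto simp: shifted_diagram_def added_boxes_def)
      then show ?thesis
        using nu(1)[of i' i] that by auto
    next
      case False
      then have "j < length \<nu>"
        using that(1) by (auto simp: shifted_diagram_def added_boxes_def)
      then show ?thesis
        using nu(2)[of i'] that \<open>i' < j'\<close> by auto
    qed
    then show ?thesis
      using True by (simp add: shifted_diagram_def)
  next
    case False
    have "j' < length \<nu> \<and> i' < j' + \<nu> ! j'"
    proof (cases "i < j")
      case True
      then have "i < length \<nu>"
        using that(1) by (auto simp: shifted_diagram_def added_boxes_def)
      then show ?thesis
        using nu(2)[of j'] that False by auto
    next
      case 2: False
      then have "j < length \<nu>" "i < j + \<nu> ! j"
        using that(1) by (auto simp: shifted_diagram_def added_boxes_def)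
      then show ?thesis
        using nu(1)[of j' j] that by auto
    qed
    then show ?thesis
      using False by (simp add: added_boxes_def)
  qed
  ultimately show ?thesis
    using young_exists[of ?Y] by (auto simp: is_doubling_def)
qed

lemma sum_list_doubling:
  assumes "is_doubling \<nu> \<mu>"
  shows "sum_list \<mu> = 2 * sum_list \<nu>"
proof -
  have sh: "shifted_diagram \<nu> = (SIGMA i:{..<length \<nu>}. {i<..i + \<nu> ! i})"
    by (auto simp: shifted_diagram_def)
  have ad: "added_boxes \<nu> = (\<lambda>(j, i). (i, j)) ` (SIGMA j:{..<length \<nu>}. {j..<j + \<nu> ! j})"
    by (auto simp: added_boxes_def)
  have "card (added_boxes \<nu>) = sum_list \<nu>"
    unfolding ad by (subst card_image) (auto simp: inj_on_def sum_list_sum_nth atLeast0LessThan)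
  moreover have "card (shifted_diagram \<nu>) = sum_list \<nu>"
    unfolding sh by (simp add: sum_list_sum_nth atLeast0LessThan)
  moreover have "finite (shifted_diagram \<nu>)" "finite (added_boxes \<nu>)"
    unfolding sh ad by auto
  moreover have "shifted_diagram \<nu> \<inter> added_boxes \<nu> = {}"
    by (auto simp: shifted_diagram_def added_boxes_def)
  ultimately show ?thesis
    using assms card_young[of \<mu>] by (simp add: is_doubling_def card_Un_disjoint)
qed


text \<open>The first three summands count the box and its arm, the last one its leg. For
  \<open>j < length \<nu>\<close> the total simplifies to
  \<open>\<nu> ! i + \<nu> ! j\<close>.\<close>

lemma hook_length_doubling:
  assumes "is_strict_partition \<nu>" "is_doubling \<nu> \<mu>" "i < length \<nu>" "i < j" "j \<le> i + \<nu> ! i"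
  shows "hook_length \<mu> (i, j) = i + \<nu> ! i - j + 1 +
    (if j < length \<nu> then j + \<nu> ! j - i - 1 else card {r. i < r \<and> r < length \<nu> \<and> j \<le> r + \<nu> ! r})"
proof -
  note nu = strict_partition_nth[OF assms(1)]
  have Y: "(r, c) \<in> young \<mu> \<longleftrightarrow> (if r < c then r < length \<nu> \<and> c \<le> r + \<nu> ! r
      else c < length \<nu> \<and> r < c + \<nu> ! c)" for r c
    using assms(2) by (auto simp: is_doubling_def shifted_diagram_def added_boxes_def)
  define L where "L = {r. i < r \<and> (r, j) \<in> young \<mu>}"
  have "finite L"
    by (rule finite_subset[of _ "fst ` young \<mu>"]) (force simp: L_def, simp add: finite_young)
  have "(r, c) \<in> hook \<mu> (i, j) \<longleftrightarrow> r = i \<and> c \<in> {j..i + \<nu> ! i} \<or> r \<in> L \<and> c = j" for r c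
    using assms(3-5) by (cases "r = i") (auto simp: hook_def L_def Y)
  then have "hook \<mu> (i, j) = Pair i ` {j..i + \<nu> ! i} \<union> (\<lambda>r. (r, j)) ` L"
    by auto
  then have "hook_length \<mu> (i, j) = card (Pair i ` {j..i + \<nu> ! i}) + card ((\<lambda>r. (r, j)) ` L)"
    using \<open>finite L\<close> unfolding hook_length_def by (simp add: card_Un_disjoint L_def disjoint_iff image_iff)
  also have "\<dots> = (i + \<nu> ! i - j + 1) + card L"
    using assms(5) by (simp add: card_image inj_on_def)
  also have "card L = (if j < length \<nu> then j + \<nu> ! j - i - 1
      else card {r. i < r \<and> r < length \<nu> \<and> j \<le> r + \<nu> ! r})"
  proof (cases "j < length \<nu>")
    case True
    \<comment> \<open>Above the diagonal such a column is complete, and the added boxes continue it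
      down to row \<open>j + \<nu> ! j - 1\<close>.\<close>
    have "r < length \<nu> \<and> j \<le> r + \<nu> ! r" if "r < j" for r
      using nu(2)[of r] that True by auto
    then have "L = {i<..<j + \<nu> ! j}"
      using True by (auto simp: L_def Y)
    then show ?thesis
      using True by simp
  next
    case False
    then have "L = {r. i < r \<and> r < length \<nu> \<and> j \<le> r + \<nu> ! r}"
      using assms(3) by (auto simp: L_def Y)
    then show ?thesis
      using False by simp
  qed
  finally show ?thesis .
qed

text \<open>Only one inclusion of the image is checked; equality follows because both sides have the same
  number of elements.\<close>

lemma hook_lengths_row:
  assumes "is_strict_partition \<nu>" "i < length \<nu>"
  defines "h \<equiv> \<lambda>j. i + \<nu> ! i - j + 1 + card {r. i < r \<and> r < length \<nu> \<and> j \<le> r + \<nu> ! r}"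
  shows "inj_on h {length \<nu>..i + \<nu> ! i}"
    and "h ` {length \<nu>..i + \<nu> ! i} = {1..\<nu> ! i} - (\<lambda>r. \<nu> ! i - \<nu> ! r) ` {i<..<length \<nu>}"
proof -
  note nu = strict_partition_nth[OF assms(1)]
  define M where "M j = {r. i < r \<and> r < length \<nu> \<and> j \<le> r + \<nu> ! r}" for j
  have M: "finite (M j)" "M j \<subseteq> {i<..<length \<nu>}" for j
    by (auto simp: M_def)
  have h: "h j = i + \<nu> ! i - j + 1 + card (M j)" for j
    by (simp add: h_def M_def)
  have less: "h j' < h j" if "j < j'" "j' \<le> i + \<nu> ! i" for j j'
  proof -
    have "card (M j') \<le> card (M j)"
      using that M by (intro card_mono) (auto simp: M_def)
    then show ?thesis
      using that by (simp add: h)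
  qed
  then show inj: "inj_on h {length \<nu>..i + \<nu> ! i}"
    by (intro linorder_inj_onI) (auto simp: less_imp_neq[symmetric] dest!: less)
  show "h ` {length \<nu>..i + \<nu> ! i} = {1..\<nu> ! i} - (\<lambda>r. \<nu> ! i - \<nu> ! r) ` {i<..<length \<nu>}"
    (is "?A = ?B")
  proof (rule card_subset_eq)
    show "?A \<subseteq> ?B"
    proof (rule image_subsetI)
      fix j assume j: "j \<in> {length \<nu>..i + \<nu> ! i}"
      have "card (M j) \<le> card {i<..<length \<nu>}"
        using M by (intro card_mono) auto
      then have "1 \<le> h j" "h j \<le> \<nu> ! i"
        using j assms(2) by (auto simp: h)
      \<comment> \<open>\<open>M j\<close> is an initial segment of the indices after
        \<open>i\<close>. It has at least \<open>r - i\<close> elements if it contains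
        \<open>r\<close> and fewer otherwise; \<open>eq\<close> contradicts both.\<close>
      moreover have "h j \<noteq> \<nu> ! i - \<nu> ! r" if r: "r \<in> {i<..<length \<nu>}" for r
      proof
        assume "h j = \<nu> ! i - \<nu> ! r"
        then have eq: "\<nu> ! r + i + 1 + card (M j) = j"
          using j nu(3)[of i r] assms(2) r by (auto simp: h)
        show False
        proof (cases "r \<in> M j")
          case True
          then have "{i<..r} \<subseteq> M j"
            using nu(1)[of _ r] r by (force simp: M_def)
          then have "card {i<..r} \<le> card (M j)"
            using M by (intro card_mono)
          moreover have "j \<le> r + \<nu> ! r" "i < r"
            using True by (auto simp: M_def)
          ultimately show False
            using eq by simp
        next
          case False
          then have "r + \<nu> ! r < j"
            using r by (simp add: M_def)
          then have "k < r" if "k \<in> M j" for k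
            using nu(1)[of r k] r that by (auto simp: M_def not_le[symmetric])
          then have "M j \<subseteq> {i<..<r}"
            using M by fastforce
          then have "card (M j) \<le> card {i<..<r}"
            by (intro card_mono) auto
          moreover have "r + \<nu> ! r < j" "i < r"
            using False r by (auto simp: M_def)
          ultimately show False
            using eq by simp
        qed
      qed
      ultimately show "h j \<in> ?B" by (simp add: image_iff)
    qed
    have "inj_on (\<lambda>r. \<nu> ! i - \<nu> ! r) {i<..<length \<nu>}"
    proof (rule linorder_inj_onI)
      fix r r' assume "r < r'" "r \<in> {i<..<length \<nu>}" "r' \<in> {i<..<length \<nu>}"
      then show "\<nu> ! i - \<nu> ! r \<noteq> \<nu> ! i - \<nu> ! r'"
        using nu(3)[of i r] nu(3)[of r r'] assms(2) by auto
    qed auto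
    moreover have "(\<lambda>r. \<nu> ! i - \<nu> ! r) ` {i<..<length \<nu>} \<subseteq> {1..\<nu> ! i}"
      using nu(3)[of i] assms(2) by (force simp: Suc_le_eq)
    ultimately have "card ?B = \<nu> ! i - (length \<nu> - Suc i)"
      by (simp add: card_Diff_subset card_image)
    moreover have "card ?A = Suc (i + \<nu> ! i) - length \<nu>"
      using inj by (simp add: card_image)
    ultimately show "card ?A = card ?B"
      using assms(2) by simp
  qed simp
qed

text \<open>Hooks in columns below \<open>length \<nu>\<close> have lengths
  \<open>\<nu> ! i + \<nu> ! j\<close> and give the pairs. In the remaining columns row
  \<open>i\<close> realizes \<open>t\<close> at most once, and does so exactly when
  \<open>\<nu> ! i\<close> is in \<open>bars\<close>.\<close>

lemma nhat_doubling:
  assumes "is_strict_partition \<nu>" "is_doubling \<nu> \<mu>" "t \<ge> 1"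
  shows "nhat t \<mu> = bar_count t (set \<nu>)"
proof -
  note nu = strict_partition_nth[OF assms(1)]
  have dist: "distinct \<nu>"
    using assms(1) by (simp add: is_strict_partition_def)
  define P where "P = {(i, j). i < j \<and> j < length \<nu> \<and> \<nu> ! i + \<nu> ! j = t}"
  define H where "H = {(i, j). i < length \<nu> \<and> length \<nu> \<le> j \<and> j \<le> i + \<nu> ! i \<and> hook_length \<mu> (i, j) = t}"
  have Y: "(i, j) \<in> young \<mu> \<longleftrightarrow> i < length \<nu> \<and> j \<le> i + \<nu> ! i" if "i < j" for i j
    using assms(2) that by (auto simp: is_doubling_def shifted_diagram_def added_boxes_def)
  have low: "hook_length \<mu> (i, j) = \<nu> ! i + \<nu> ! j" "j \<le> i + \<nu> ! i" if "i < j" "j < length \<nu>" for i j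
    using hook_length_doubling[OF assms(1,2), of i j] that nu(2)[of i] by auto
  have "{(i, j) \<in> young \<mu>. j > i \<and> hook_length \<mu> (i, j) = t} = P \<union> H"
    using low by (auto simp: P_def H_def Y not_less)
  moreover have "finite P"
    by (rule finite_subset[of _ "{..<length \<nu>} \<times> {..<length \<nu>}"]) (auto simp: P_def)
  moreover have "finite H"
    by (rule finite_subset[of _ "SIGMA i:{..<length \<nu>}. {..i + \<nu> ! i}"]) (auto simp: H_def)
  moreover have "P \<inter> H = {}"
    by (auto simp: P_def H_def)
  ultimately have "nhat t \<mu> = card P + card H"
    by (simp add: nhat_def card_Un_disjoint)
  also have "card P = card (bar_pairs t (set \<nu>))"
  proof (rule bij_betw_same_card)
    show "bij_betw (\<lambda>(i, j). (\<nu> ! j, \<nu> ! i)) P (bar_pairs t (set \<nu>))"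
      unfolding bij_betw_def
    proof
      show "inj_on (\<lambda>(i, j). (\<nu> ! j, \<nu> ! i)) P"
        using dist by (auto simp: inj_on_def P_def nth_eq_iff_index_eq)
      have "(a, b) \<in> (\<lambda>(i, j). (\<nu> ! j, \<nu> ! i)) ` P" if "(a, b) \<in> bar_pairs t (set \<nu>)" for a b
      proof -
        from that obtain i j where ij: "i < length \<nu>" "j < length \<nu>" "b = \<nu> ! i" "a = \<nu> ! j"
          by (auto simp: bar_pairs_def in_set_conv_nth)
        moreover have "i < j"
          using ij that nu(3)[of j i] by (cases i j rule: linorder_cases) (auto simp: bar_pairs_def)
        ultimately have "(i, j) \<in> P"
          using that by (auto simp: P_def bar_pairs_def)
        then show ?thesis
          using ij by (intro image_eqI[of _ _ "(i, j)"]) auto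
      qed
      then show "(\<lambda>(i, j). (\<nu> ! j, \<nu> ! i)) ` P = bar_pairs t (set \<nu>)"
        using nu(3) by (auto simp: P_def bar_pairs_def)
    qed
  qed
  also have "card H = card (bars t (set \<nu>))"
  proof (rule bij_betw_same_card)
    define h where "h i j = i + \<nu> ! i - j + 1 + card {r. i < r \<and> r < length \<nu> \<and> j \<le> r + \<nu> ! r}" for i j
    have h: "hook_length \<mu> (i, j) = h i j" if "i < length \<nu>" "length \<nu> \<le> j" "j \<le> i + \<nu> ! i" for i j
      using hook_length_doubling[OF assms(1,2), of i j] that by (simp add: h_def)
    note row = hook_lengths_row[OF assms(1), folded h_def]
    have H: "H = {(i, j). i < length \<nu> \<and> j \<in> {length \<nu>..i + \<nu> ! i} \<and> h i j = t}"
      using h by (auto simp: H_def)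
    have img: "t \<in> h i ` {length \<nu>..i + \<nu> ! i} \<longleftrightarrow> \<nu> ! i \<in> bars t (set \<nu>)" if "i < length \<nu>" for i
    proof -
      \<comment> \<open>As \<open>t \<ge> 1\<close>, a part \<open>\<nu> ! i - t\<close> must come
        after index \<open>i\<close>. If \<open>t = \<nu> ! i\<close>, both sides are false since
        all parts are positive.\<close>
      have "\<nu> ! i - t \<in> set \<nu> \<longleftrightarrow> (\<exists>r\<in>{i<..<length \<nu>}. t = \<nu> ! i - \<nu> ! r)" if t: "t \<le> \<nu> ! i"
      proof
        assume "\<nu> ! i - t \<in> set \<nu>"
        then obtain r where r: "r < length \<nu>" "\<nu> ! r = \<nu> ! i - t"
          by (auto simp: in_set_conv_nth)
        moreover have "i < r"
          using r nu(3)[of r i] nu(4)[of i] t assms(3) \<open>i < length \<nu>\<close>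
          by (cases i r rule: linorder_cases) auto
        ultimately show "\<exists>r\<in>{i<..<length \<nu>}. t = \<nu> ! i - \<nu> ! r"
          using t by (intro bexI[of _ r]) auto
      next
        assume "\<exists>r\<in>{i<..<length \<nu>}. t = \<nu> ! i - \<nu> ! r"
        then obtain r where "r \<in> {i<..<length \<nu>}" "t = \<nu> ! i - \<nu> ! r" ..
        then show "\<nu> ! i - t \<in> set \<nu>"
          using nu(3)[of i r] \<open>i < length \<nu>\<close> by auto
      qed
      then show ?thesis
        unfolding row(2)[OF that] using that assms(3) by (auto simp: bars_def)
    qed
    show "bij_betw (\<lambda>(i, j). \<nu> ! i) H (bars t (set \<nu>))"
      unfolding bij_betw_def
    proof
      \<comment> \<open>Distinct parts determine \<open>i\<close>; then \<open>j\<close> is fixed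
        because hook lengths in this stretch of the row are distinct.\<close>
      show "inj_on (\<lambda>(i, j). \<nu> ! i) H"
        using dist row(1) by (auto simp: inj_on_def H nth_eq_iff_index_eq)
      have "a \<in> (\<lambda>(i, j). \<nu> ! i) ` H" if "a \<in> bars t (set \<nu>)" for a
      proof -
        from that obtain i where i: "i < length \<nu>" "a = \<nu> ! i"
          by (auto simp: bars_def in_set_conv_nth)
        then have "t \<in> h i ` {length \<nu>..i + \<nu> ! i}"
          using img that by simp
        then obtain j where "(i, j) \<in> H"
          using i(1) by (auto simp: H)
        then show ?thesis
          using i by (intro image_eqI[of _ _ "(i, j)"]) auto
      qed
      moreover have "\<nu> ! i \<in> bars t (set \<nu>)" if "(i, j) \<in> H" for i j
      proof -
        from that have "i < length \<nu>" "t \<in> h i ` {length \<nu>..i + \<nu> ! i}"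
          unfolding H by blast+
        then show ?thesis
          using img by simp
      qed
      ultimately show "(\<lambda>(i, j). \<nu> ! i) ` H = bars t (set \<nu>)"
        by auto
    qed
  qed
  finally show ?thesis
    by (simp add: bar_count_def)
qed


section \<open>From doubled distinct partitions to finite sets\<close>

lemma is_doubling_unique: "is_doubling \<nu> \<mu> \<Longrightarrow> is_doubling \<nu> \<mu>' \<Longrightarrow> \<mu> = \<mu>'"
  by (auto simp: is_doubling_def intro: young_inj)

text \<open>Inverse of doubling: to the right of the diagonal, the doubled diagram is the shifted
  diagram, whose row lengths are the parts.\<close>

definition halve :: "nat list \<Rightarrow> nat set" where
  "halve \<mu> = (\<lambda>i. card {j. i < j \<and> (i, j) \<in> young \<mu>}) ` {i. (i, Suc i) \<in> young \<mu>}"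

lemma halve_doubling:
  assumes "is_strict_partition \<nu>" "is_doubling \<nu> \<mu>"
  shows "halve \<mu> = set \<nu>"
proof -
  have Y: "(i, j) \<in> young \<mu> \<longleftrightarrow> i < length \<nu> \<and> j \<le> i + \<nu> ! i" if "i < j" for i j
    using assms(2) that by (auto simp: is_doubling_def shifted_diagram_def added_boxes_def)
  have "(i, Suc i) \<in> young \<mu> \<longleftrightarrow> i < length \<nu>" for i
    using Y[of i "Suc i"] strict_partition_nth(4)[OF assms(1), of i] by auto
  moreover have "card {j. i < j \<and> (i, j) \<in> young \<mu>} = \<nu> ! i" if "i < length \<nu>" for i
  proof -
    have "{j. i < j \<and> (i, j) \<in> young \<mu>} = {i<..i + \<nu> ! i}"
      using Y that by auto
    then show ?thesis by simp
  qed
  ultimately show ?thesis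
    by (auto simp: halve_def in_set_conv_nth image_iff)
qed

lemma strict_partition_of_set:
  fixes S :: "nat set"
  assumes "finite S" "0 \<notin> S"
  shows "is_strict_partition (rev (sorted_list_of_set S))"
  using assms by (auto simp: is_strict_partition_def is_partition_def sorted_wrt_rev)
    (metis gr0I)

lemma strict_partition_rev_sorted:
  assumes "is_strict_partition \<nu>"
  shows "rev (sorted_list_of_set (set \<nu>)) = \<nu>"
proof -
  have "sorted (rev \<nu>)" "distinct (rev \<nu>)"
    using assms by (auto simp: is_strict_partition_def is_partition_def sorted_wrt_rev)
  then have "sorted_list_of_set (set (rev \<nu>)) = rev \<nu>"
    by (rule sorted_list_of_set.idem_if_sorted_distinct)
  then show ?thesis by simp
qed

text \<open>Finite sets of positive integers correspond to doubled distinct partitions through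
  \<open>D\<close> and \<open>halve\<close>. Doubling doubles the size, which explains the exponent
  \<open>2 * \<Sum>S\<close> in \<open>subset_gf\<close>.\<close>

lemma Fhat_eq_subset_gf:
  assumes "t \<ge> 1"
  shows "Fhat t x = subset_gf (\<lambda>S. fps_const x ^ bar_count t S) {0<..}"
proof (rule fps_ext)
  fix n :: nat
  define D where "D S = (SOME \<mu>. is_doubling (rev (sorted_list_of_set S)) \<mu>)" for S
  define T where "T = {S. S \<subseteq> {0<..n} \<and> 2 * \<Sum>S = n}"
  have D: "is_doubling (rev (sorted_list_of_set S)) (D S)" if "finite S" "0 \<notin> S" for S
    unfolding D_def using doubling_exists[OF strict_partition_of_set[OF that]] by (rule someI_ex)
  have T: "finite S" "0 \<notin> S" "2 * \<Sum>S = n" if "S \<in> T" for S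
    using that by (auto simp: T_def intro: finite_subset)
  have "subset_gf (\<lambda>S. fps_const x ^ bar_count t S) {0<..} $ n =
      (\<Sum>S\<in>Pow ({0<..} \<inter> {..n}). if 2 * \<Sum>S = n then x ^ bar_count t S else 0)"
    unfolding subset_gf_def fps_nth_Abs_fps fps_sum_nth
    by (intro sum.cong refl) (auto simp: fps_X_power_mult_nth fps_const_power)
  also have "\<dots> = (\<Sum>S\<in>T. x ^ bar_count t S)"
    unfolding T_def by (intro sum.mono_neutral_cong_right) auto
  also have "\<dots> = (\<Sum>\<mu> | \<mu> \<in> DD \<and> sum_list \<mu> = n. x ^ nhat t \<mu>)"
  proof (rule sum.reindex_bij_witness[where i = halve and j = D])
    fix S assume "S \<in> T"
    note S = T[OF this]
    note str = strict_partition_of_set[OF S(1,2)] and dbl = D[OF S(1,2)]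
    show "halve (D S) = S"
      using halve_doubling[OF str dbl] S(1) by simp
    have "sum_list (rev (sorted_list_of_set S)) = \<Sum>S"
      using S(1) by (subst distinct_sum_list_conv_Sum) auto
    then show "D S \<in> {\<mu> \<in> DD. sum_list \<mu> = n}"
      using str dbl sum_list_doubling[OF dbl] S(3) by (auto simp: DD_def)
    show "x ^ nhat t (D S) = x ^ bar_count t S"
      using nhat_doubling[OF str dbl assms] S(1) by simp
  next
    fix \<mu> assume "\<mu> \<in> {\<mu> \<in> DD. sum_list \<mu> = n}"
    then obtain \<nu> where \<nu>: "is_strict_partition \<nu>" "is_doubling \<nu> \<mu>" and n: "sum_list \<mu> = n"
      by (auto simp: DD_def)
    have 0: "0 \<notin> set \<nu>"
      using \<nu>(1) by (auto simp: is_strict_partition_def is_partition_def)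
    have "\<Sum>(set \<nu>) = sum_list \<nu>"
      using \<nu>(1) by (simp add: is_strict_partition_def distinct_sum_list_conv_Sum)
    moreover have "a \<le> sum_list \<nu>" if "a \<in> set \<nu>" for a
      using that by (simp add: member_le_sum_list)
    ultimately show "halve \<mu> \<in> T"
      using halve_doubling[OF \<nu>] sum_list_doubling[OF \<nu>(2)] n 0 by (fastforce simp: T_def intro: gr0I)
    show "D (halve \<mu>) = \<mu>"
      using D[of "set \<nu>"] 0 \<nu>(2) unfolding halve_doubling[OF \<nu>] strict_partition_rev_sorted[OF \<nu>(1)]
      by (auto intro: is_doubling_unique)
  qed
  finally show "Fhat t x $ n = subset_gf (\<lambda>S. fps_const x ^ bar_count t S) {0<..} $ n"
    by (simp add: Fhat_def)
qed

theorem theorem1p2: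
  fixes t :: nat and x :: "'a::field_char_0"
  assumes "t \<ge> 1"
  shows "(odd t \<longrightarrow>
      Fhat t x =
        qpoch (- (fps_X ^ 2)) (fps_X ^ 2)
        * qpoch (fps_const (1 - x) * fps_X ^ (2 * t)) (fps_X ^ (2 * t)) ^ ((t - 1) div 2)
        * qpoch (fps_const (1 - x) * fps_X ^ (2 * t)) (fps_X ^ (4 * t)))
    \<and> (even t \<longrightarrow> (\<forall>s. s ^ 2 = 1 - x \<longrightarrow>
      Fhat t x =
        qpoch (- (fps_X ^ 2)) (fps_X ^ 2)
        * qpoch (fps_const (1 - x) * fps_X ^ (2 * t)) (fps_X ^ (2 * t)) ^ ((t - 2) div 2)
        * qpoch (fps_const (1 - x) * fps_X ^ (2 * t)) (fps_X ^ (4 * t))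
        * (fps_const (1 / 2)
            * (qpoch (- (fps_const s * fps_X ^ t)) (- (fps_X ^ t))
               + qpoch (fps_const s * fps_X ^ t) (- (fps_X ^ t))))))"
proof -
  have "1 - fps_const (1 - x) = fps_const x"
    unfolding fps_const_1_eq_1[symmetric] fps_const_sub by simp
  then have F: "Fhat t x = subset_gf (\<lambda>S. (1 - fps_const (1 - x)) ^ bar_count t S) {0<..}"
    using Fhat_eq_subset_gf[OF assms] by metis
  show ?thesis
  proof (intro conjI impI allI)
    assume "odd t"
    then show "Fhat t x =
        qpoch (- (fps_X ^ 2)) (fps_X ^ 2)
        * qpoch (fps_const (1 - x) * fps_X ^ (2 * t)) (fps_X ^ (2 * t)) ^ ((t - 1) div 2)
        * qpoch (fps_const (1 - x) * fps_X ^ (2 * t)) (fps_X ^ (4 * t))"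
      unfolding F by (rule bar_gf_product(1)[OF assms])
  next
    fix s assume "even t" "s ^ 2 = 1 - x"
    then have "fps_const (1 - x) = fps_const s ^ 2"
      by (simp add: fps_const_power)
    note two = bar_gf_product(2)[OF assms \<open>even t\<close> this, folded F]
    \<comment> \<open>The even case is available for twice the series; 2 is invertible in
      characteristic 0.\<close>
    have "Fhat t x = fps_const (1 / 2) * (2 * Fhat t x)"
      unfolding mult.assoc[symmetric] numeral_fps_const fps_const_mult by simp
    then show "Fhat t x =
        qpoch (- (fps_X ^ 2)) (fps_X ^ 2)
        * qpoch (fps_const (1 - x) * fps_X ^ (2 * t)) (fps_X ^ (2 * t)) ^ ((t - 2) div 2)
        * qpoch (fps_const (1 - x) * fps_X ^ (2 * t)) (fps_X ^ (4 * t))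
        * (fps_const (1 / 2)
            * (qpoch (- (fps_const s * fps_X ^ t)) (- (fps_X ^ t))
               + qpoch (fps_const s * fps_X ^ t) (- (fps_X ^ t))))"
      unfolding two by (simp only: mult_ac)
  qed
qed

end
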